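(* Let $(Y_m)_{m\in\mathbb{Z}}$ be a stationary renewal process that is a (Hermitian) determinantal point process and that is nontrivial, i.e. not an i.i.d. Bernoulli sequence. Let $(Y'_m)_{m\in\mathbb{Z}}$ be an independent copy of $(Y_m)$ and define $Z_{2m}=Y_m$ and $Z_{2m+1}=Y'_m$ for $m\in\mathbb{Z}$. Then $(Z_m)_{m\in\mathbb{Z}}$ is a determinantal point process and a regenerative process of order $2$, but there are no parameters $c>0$, $d\ge0$ and $p\in[0,1]$ such that $(X_m\cdot B_m)_{m\in\mathbb{Z}}$ equals $(Z_m)_{m\in\mathbb{Z}}$ in distribution. Here $X_m=\mathbf{1}_{\{z_m\in T\}}$ for the weighted random spanning tree $T$ of the enhanced helix-3-graph $G^{H_3'}$ with weights $1$ on the edges $h_m$, $c$ on the edges $z_m$ and $d$ on the edges $g_m$, and $(B_m)_{m\in\mathbb{Z}}$ is a family of i.i.d. Bernoulli random variables with parameter $p$, independent of $X$.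
   Context: Enhanced helix-3-graph $G^{H_3'}$: vertex set $\mathbb{Z}$, edges $z_m=\{m-1,m\}$, $h_m=\{m-3,m\}$ and $g_m=\{m-2,m\}$ for $m\in\mathbb{Z}$. The weight of a spanning tree is the product of the weights of its edges. The weighted spanning tree measure on $G^{H_3'}$ is the limit as $n\to\infty$ of the measures on spanning trees of the subgraph induced by $\{-n,\dots,n\}$ under which each tree has probability proportional to its weight (the limit exists, in the sense of convergence of probabilities of events depending on finitely many edges, and is concentrated on spanning trees). A $\{0,1\}^{\mathbb{Z}}$-valued process $X$ is a (Hermitian) determinantal point process with matrix $A$ (Hermitian, indexed by $\mathbb{Z}$) if $\mathbf{P}[X_s=1\text{ for all }s\in S]=\det((A_{ij})_{i,j\in S})$ for all finite $S\subset\mathbb{Z}$. A stationary process $X$ is regenerative of order $k\in\{1,2,\dots\}$ if for all measurable $B\subset\{0,1\}^{\{-k,-k-1,\dots\}}$ and $C\subset\{0,1\}^{\{1,2,\dots\}}$, $\mathbf{P}[X|_{\{1,2,\dots\}}\in C\mid X|_{\{-k,-k-1,\dots\}}\in B,\ X_0=X_{-1}=\dots=X_{-k+1}=1]=\mathbf{P}[X|_{\{1,2,\dots\}}\in C\mid X_0=X_{-1}=\dots=X_{-k+1}=1]$ (whenever the conditioning events have positive probability). A renewal process is a regenerative process of order 1. *)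

theory Defs
  imports "HOL-Probability.Probability"
begin

section \<open>Binary processes indexed by the integers\<close>

text \<open>The values 0 and 1 are represented by \<^term>\<open>False\<close> and \<^term>\<open>True\<close>;
  in particular the product of two such variables is their conjunction.\<close>

abbreviation config_space :: "int set \<Rightarrow> (int \<Rightarrow> bool) measure" where
  "config_space I \<equiv> PiM I (\<lambda>_. count_space (UNIV :: bool set))"

definition binary_process :: "'a measure \<Rightarrow> (int \<Rightarrow> 'a \<Rightarrow> bool) \<Rightarrow> bool" where
  "binary_process M X \<longleftrightarrow> (\<forall>m. X m \<in> M \<rightarrow>\<^sub>M count_space UNIV)"

definition process_law :: "'a measure \<Rightarrow> (int \<Rightarrow> 'a \<Rightarrow> bool) \<Rightarrow> (int \<Rightarrow> bool) measure" where
  "process_law M X = distr M (config_space UNIV) (\<lambda>\<omega> m. X m \<omega>)"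

definition independent_processes ::
    "'a measure \<Rightarrow> (int \<Rightarrow> 'a \<Rightarrow> bool) \<Rightarrow> (int \<Rightarrow> 'a \<Rightarrow> bool) \<Rightarrow> bool" where
  "independent_processes M X Y \<longleftrightarrow>
     prob_space.indep_var M (config_space UNIV) (\<lambda>\<omega> m. X m \<omega>)
                            (config_space UNIV) (\<lambda>\<omega> m. Y m \<omega>)"

definition stationary :: "'a measure \<Rightarrow> (int \<Rightarrow> 'a \<Rightarrow> bool) \<Rightarrow> bool" where
  "stationary M X \<longleftrightarrow> binary_process M X \<and>
     (\<forall>k. process_law M (\<lambda>m. X (m + k)) = process_law M X)"

definition iid_bernoulli :: "'a measure \<Rightarrow> real \<Rightarrow> (int \<Rightarrow> 'a \<Rightarrow> bool) \<Rightarrow> bool" where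
  "iid_bernoulli M p X \<longleftrightarrow>
     prob_space.indep_vars M (\<lambda>_. count_space UNIV) X UNIV \<and>
     (\<forall>m. distr M (count_space UNIV) (X m) = measure_pmf (bernoulli_pmf p))"

definition regenerative :: "nat \<Rightarrow> 'a measure \<Rightarrow> (int \<Rightarrow> 'a \<Rightarrow> bool) \<Rightarrow> bool" where
  "regenerative k M X \<longleftrightarrow> 1 \<le> k \<and> stationary M X \<and>
     (\<forall>B \<in> sets (config_space {..- int k}). \<forall>C \<in> sets (config_space {1..}).
        0 < \<P>(\<omega> in M. (\<lambda>m\<in>{..- int k}. X m \<omega>) \<in> B \<and> (\<forall>j\<in>{- int k + 1..0}. X j \<omega>)) \<longrightarrow>
        \<P>(\<omega> in M. (\<lambda>m\<in>{1..}. X m \<omega>) \<in> C \<bar>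
            (\<lambda>m\<in>{..- int k}. X m \<omega>) \<in> B \<and> (\<forall>j\<in>{- int k + 1..0}. X j \<omega>)) =
        \<P>(\<omega> in M. (\<lambda>m\<in>{1..}. X m \<omega>) \<in> C \<bar> \<forall>j\<in>{- int k + 1..0}. X j \<omega>))"

definition renewal :: "'a measure \<Rightarrow> (int \<Rightarrow> 'a \<Rightarrow> bool) \<Rightarrow> bool" where
  "renewal M X \<longleftrightarrow> regenerative 1 M X"


section \<open>Determinantal processes\<close>

text \<open>The determinant of a matrix whose rows and columns are indexed by a finite set \<open>S\<close>.
  Library determinants are indexed by a finite type or by an initial segment of the naturals.\<close>

definition det_on :: "'i set \<Rightarrow> ('i \<Rightarrow> 'i \<Rightarrow> 'b :: comm_ring_1) \<Rightarrow> 'b" where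
  "det_on S A = (\<Sum>\<pi> | \<pi> permutes S. of_int (sign \<pi>) * (\<Prod>i\<in>S. A i (\<pi> i)))"

lemma det_on_UNIV: "det_on UNIV A = det (\<chi> i j. A i j)"
  by (simp add: det_on_def det_def)

definition determinantal :: "'a measure \<Rightarrow> (int \<Rightarrow> 'a \<Rightarrow> bool) \<Rightarrow> bool" where
  "determinantal M X \<longleftrightarrow> binary_process M X \<and>
     (\<exists>A :: int \<Rightarrow> int \<Rightarrow> complex. (\<forall>i j. A j i = cnj (A i j)) \<and>
        (\<forall>S. finite S \<longrightarrow> complex_of_real \<P>(\<omega> in M. \<forall>s\<in>S. X s \<omega>) = det_on S A))"


section \<open>Weighted spanning trees of the enhanced helix-3-graph\<close>

text \<open>The spanning trees of AFP Graph Theory exclude only directed cycles, so they are not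
  the spanning trees of an undirected graph. Here a graph on \<open>V\<close> is given by its set of edges,
  each edge being a set of two vertices, and a cycle by the list of its distinct vertices.\<close>

definition connects :: "'v set \<Rightarrow> 'v set set \<Rightarrow> bool" where
  "connects V T \<longleftrightarrow> (\<forall>u\<in>V. \<forall>v\<in>V. (u, v) \<in> {(x, y). {x, y} \<in> T}\<^sup>*)"

definition has_cycle :: "'v set set \<Rightarrow> bool" where
  "has_cycle T \<longleftrightarrow> (\<exists>vs. 3 \<le> length vs \<and> distinct vs \<and>
     (\<forall>i<length vs. {vs ! i, vs ! (Suc i mod length vs)} \<in> T))"

definition is_spanning_tree :: "'v set \<Rightarrow> 'v set set \<Rightarrow> 'v set set \<Rightarrow> bool" where
  "is_spanning_tree V E T \<longleftrightarrow> T \<subseteq> E \<and> connects V T \<and> \<not> has_cycle T"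

definition z_edge :: "int \<Rightarrow> int set" where "z_edge m = {m - 1, m}"
definition g_edge :: "int \<Rightarrow> int set" where "g_edge m = {m - 2, m}"
definition h_edge :: "int \<Rightarrow> int set" where "h_edge m = {m - 3, m}"

definition helix_edges :: "int set set" where
  "helix_edges = range z_edge \<union> range g_edge \<union> range h_edge"

definition edge_weight :: "real \<Rightarrow> real \<Rightarrow> int set \<Rightarrow> real" where
  "edge_weight c d e =
     (if e \<in> range z_edge then c else if e \<in> range g_edge then d else 1)"

definition tree_weight :: "real \<Rightarrow> real \<Rightarrow> int set set \<Rightarrow> real" where
  "tree_weight c d t = (\<Prod>e\<in>t. edge_weight c d e)"

definition finite_trees :: "nat \<Rightarrow> int set set set" where
  "finite_trees n =
     {t. is_spanning_tree {- int n..int n} {e \<in> helix_edges. e \<subseteq> {- int n..int n}} t}"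

definition finite_tree_prob :: "real \<Rightarrow> real \<Rightarrow> nat \<Rightarrow> int set set set \<Rightarrow> real" where
  "finite_tree_prob c d n \<A> =
     (\<Sum>t\<in>finite_trees n \<inter> \<A>. tree_weight c d t) / (\<Sum>t\<in>finite_trees n. tree_weight c d t)"

text \<open>\<open>T\<close> is a random set of edges, defined on \<open>N\<close>, whose law is the limit of the weighted
  spanning tree measures on the finite induced subgraphs. The events depending only on a finite
  set \<open>F\<close> of edges are \<open>{t. t \<inter> F \<in> \<A>}\<close> with \<open>\<A> \<subseteq> Pow F\<close>; their probabilities
  determine the law of \<open>T\<close>.\<close>

definition weighted_random_tree ::
    "real \<Rightarrow> real \<Rightarrow> 'b measure \<Rightarrow> ('b \<Rightarrow> int set set) \<Rightarrow> bool" where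
  "weighted_random_tree c d N T \<longleftrightarrow>
     (\<forall>\<omega>\<in>space N. T \<omega> \<subseteq> helix_edges) \<and>
     (\<forall>e\<in>helix_edges. {\<omega> \<in> space N. e \<in> T \<omega>} \<in> sets N) \<and>
     (\<forall>F \<A>. finite F \<longrightarrow> F \<subseteq> helix_edges \<longrightarrow> \<A> \<subseteq> Pow F \<longrightarrow>
        (\<lambda>n. finite_tree_prob c d n {t. t \<inter> F \<in> \<A>})
          \<longlonglongrightarrow> \<P>(\<omega> in N. T \<omega> \<inter> F \<in> \<A>))"

end

theory Submission
  imports Defs "HOL-Library.Transitive_Closure_Table"
begin

text \<open>
  The processes \<open>Y\<close> and \<open>Y'\<close> have the same law, so an interleaving of the two is stationary, and it inherits
  the two positive properties by independence. The kernel of \<open>Z\<close> is block diagonal with two copies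
  of the kernel of \<open>Y\<close> (\<open>determinantal_interleave\<close>). Two consecutive ones of \<open>Z\<close> are a one of \<open>Y\<close>
  next to a one of \<open>Y'\<close>; each of them separates the past of its process from its future, and
  independence makes the two separations hold jointly (\<open>regenerative_interleave\<close>).

  The negative assertion comes from correlations at odd distance. There \<open>Z\<close> has none, since the two
  coordinates belong to independent processes. Nontriviality makes the density of \<open>Z\<close>
  positive (the zero process is Bernoulli with parameter \<open>0\<close>); hence \<open>p > 0\<close> in a representation
  \<open>Z = X B\<close>, thinning can be undone, and \<open>X\<close> has a positive density \<open>\<alpha>\<close> and no correlation at odd
  distance either.

  For weighted spanning trees the covariance of two edges \<open>e\<close> and \<open>f\<close> is \<open>- w\<^sub>e w\<^sub>f u\<^sup>2\<close>, where \<open>u\<close> is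
  the voltage drop along \<open>e\<close> when a unit current is sent through the network from one end of \<open>f\<close>
  to the other (\<open>two_edges\<close>). Let \<open>y\<^sub>m\<close> be the limiting voltage drop along \<open>z\<^sub>m\<close> for a unit current
  between the ends of \<open>z\<^sub>0\<close>. Then \<open>y\<^sub>m = 0\<close> for odd \<open>m\<close>, while \<open>c y\<^sub>0 = \<alpha>\<close>. No net current crosses
  the cut between \<open>m - 1\<close> and \<open>m\<close> for \<open>m \<ge> 1\<close>, which reads
  \<open>y\<^bsub>m-2\<^esub> + (2 + d) y\<^bsub>m-1\<^esub> + (3 + 2d + c) y\<^sub>m + (2 + d) y\<^bsub>m+1\<^esub> + y\<^bsub>m+2\<^esub> = 0\<close>.
  For odd \<open>m\<close> only two terms survive, and since \<open>2 + d \<noteq> 0\<close> the drops \<open>y\<^sub>0, y\<^sub>2, y\<^sub>4, \<dots>\<close> have alternating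
  signs and a constant absolute value \<open>\<alpha> / c\<close>. The energy of a unit current is the finite number
  \<open>y\<^sub>0\<close>, but these edges alone would contribute infinitely much
  (\<open>helix_odd_lags_uncorrelated\<close>).

  The electrical facts hold on every finite graph. Following Kirchhoff, the potential is
  a weighted count of spanning forests with two components, and that it solves the network equation
  follows by letting each forest grow into a tree along an edge that joins its components
  (\<open>weak_Kirchhoff\<close>).
\<close>


section \<open>Spanning trees as minimal connected edge sets\<close>

definition linked :: "'v set set \<Rightarrow> ('v \<times> 'v) set" where
  "linked T = {(x, y). {x, y} \<in> T}\<^sup>*"

lemma linked_refl [simp, intro]: "(x, x) \<in> linked T"
  by (simp add: linked_def)

lemma linked_edge: "{x, y} \<in> T \<Longrightarrow> (x, y) \<in> linked T"
  unfolding linked_def by (rule r_into_rtrancl) simp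

lemma linked_sym: "(x, y) \<in> linked T \<Longrightarrow> (y, x) \<in> linked T"
proof -
  have "sym {(x, y). {x, y} \<in> T}"
    by (auto intro!: symI simp: insert_commute)
  then show "(x, y) \<in> linked T \<Longrightarrow> (y, x) \<in> linked T"
    unfolding linked_def using sym_rtrancl symD by metis
qed

lemma linked_trans: "(x, y) \<in> linked T \<Longrightarrow> (y, z) \<in> linked T \<Longrightarrow> (x, z) \<in> linked T"
  unfolding linked_def by (rule rtrancl_trans)

lemma linked_mono: "S \<subseteq> T \<Longrightarrow> (x, y) \<in> linked S \<Longrightarrow> (x, y) \<in> linked T"
  unfolding linked_def by (erule rtrancl_mono[THEN subsetD, rotated]) auto

lemma linked_insertD:
  assumes "(s, t) \<in> linked (insert {a, b} R)"
  shows "(s, t) \<in> linked R \<or> (s, a) \<in> linked R \<and> (b, t) \<in> linked R \<or>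
    (s, b) \<in> linked R \<and> (a, t) \<in> linked R"
  using assms[unfolded linked_def]
proof (induction rule: rtrancl_induct)
  case base
  then show ?case by simp
next
  case (step t u)
  show ?case
  proof (cases "{t, u} \<in> R")
    case True
    then show ?thesis using step.IH linked_trans linked_edge by meson
  next
    case False
    then have "{t, u} = {a, b}" using step.hyps by auto
    then have "t = a \<and> u = b \<or> t = b \<and> u = a" by (auto simp: doubleton_eq_iff)
    then show ?thesis using step.IH by auto
  qed
qed

lemma has_cycle_imp_linked:
  assumes "has_cycle T"
  obtains x y where "{x, y} \<in> T" "(x, y) \<in> linked (T - {{x, y}})"
proof -
  obtain vs where vs: "3 \<le> length vs" "distinct vs"
    and E: "\<And>i. i < length vs \<Longrightarrow> {vs ! i, vs ! (Suc i mod length vs)} \<in> T"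
    using assms unfolding has_cycle_def by blast
  define l where "l = length vs - 1"
  have l: "2 \<le> l" "length vs = Suc l" using vs by (auto simp: l_def)
  have e: "{vs ! 0, vs ! l} \<in> T"
    using E[of l] l by (simp add: insert_commute)
  have "k \<le> l \<Longrightarrow> (vs ! 0, vs ! k) \<in> linked (T - {{vs ! 0, vs ! l}})" for k
  proof (induction k)
    case (Suc k)
    have "{vs ! k, vs ! Suc k} \<in> T" using E[of k] l Suc.prems by simp
    moreover have "{vs ! k, vs ! Suc k} \<noteq> {vs ! 0, vs ! l}"
      using vs(2) l Suc.prems by (auto simp: doubleton_eq_iff nth_eq_iff_index_eq)
    ultimately show ?case
      using Suc linked_edge linked_trans by (metis DiffI Suc_leD singletonD)
  qed simp
  then show thesis using e that by blast
qed

text \<open>The detour from \<open>x\<close> to \<open>y\<close> can be taken without repeated vertices. It then has at least two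
  edges, as the edge between \<open>x\<close> and \<open>y\<close> is excluded, and closes up to a cycle of length at least three.\<close>
lemma linked_imp_has_cycle:
  assumes "{x, y} \<in> T" "x \<noteq> y" "(x, y) \<in> linked (T - {{x, y}})"
  shows "has_cycle T"
proof -
  let ?r = "\<lambda>a b. {a, b} \<in> T - {{x, y}}"
  have "?r\<^sup>*\<^sup>* x y"
    using assms(3) unfolding linked_def rtrancl_def by simp
  then obtain xs0 where "rtrancl_path ?r x xs0 y"
    by (auto simp: rtranclp_eq_rtrancl_path)
  then obtain xs where xs: "rtrancl_path ?r x xs y" "distinct (x # xs)"
    by (rule rtrancl_path_distinct)
  let ?vs = "x # xs"
  have ne: "xs \<noteq> []" using xs(1) assms(2) by (auto elim: rtrancl_path.cases)
  have step: "{?vs ! i, ?vs ! Suc i} \<in> T - {{x, y}}" if "i < length xs" for i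
    using rtrancl_path_nth[OF xs(1) that] by simp
  have last: "?vs ! length xs = y"
    using rtrancl_path_last[OF xs(1) ne] ne by (simp add: last_conv_nth nth_Cons')
  have "length xs \<noteq> 1"
    using step[of 0] last ne by auto
  then have len: "3 \<le> length ?vs" using ne by (cases xs) (auto simp: neq_Nil_conv Suc_le_eq)
  have "{?vs ! i, ?vs ! (Suc i mod length ?vs)} \<in> T" if "i < length ?vs" for i
  proof (cases "i = length xs")
    case True
    then show ?thesis using last assms(1) by (simp add: insert_commute)
  next
    case False
    then show ?thesis using step[of i] that by simp
  qed
  then show ?thesis using len xs(2) unfolding has_cycle_def by blast
qed

section \<open>Potentials from two-component forests\<close>

text \<open>The order of the vertices is used to orient edges, from \<open>Min e\<close> to \<open>Max e\<close>. Reversing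
  an edge changes the sign of every difference along it, and the results below are invariant under this.\<close>
definition edge_diff :: "('v :: linorder \<Rightarrow> real) \<Rightarrow> 'v set \<Rightarrow> real" where
  "edge_diff \<theta> e = \<theta> (Max e) - \<theta> (Min e)"

text \<open>When \<open>F\<close> has two components, its differences along an edge \<open>g\<close> are \<open>1\<close> or \<open>-1\<close> if \<open>g\<close>
  joins the components, and \<open>0\<close> otherwise.\<close>
definition side :: "'v set set \<Rightarrow> 'v \<Rightarrow> 'v \<Rightarrow> real" where
  "side F y v = of_bool ((v, y) \<in> linked F)"

locale finite_graph =
  fixes V :: "'v :: linorder set" and E :: "'v set set"
  assumes finite_E: "finite E"
    and edge_ex: "\<And>e. e \<in> E \<Longrightarrow> \<exists>x\<in>V. \<exists>y\<in>V. x < y \<and> e = {x, y}"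
begin

definition trees :: "'v set set set" where
  "trees = {T. is_spanning_tree V E T}"

text \<open>These are the spanning forests with two components, one containing \<open>Min f\<close> and the other
  containing \<open>Max f\<close>.\<close>
definition forests :: "'v set \<Rightarrow> 'v set set set" where
  "forests f = {F. f \<notin> F \<and> insert f F \<in> trees}"

definition total :: "('v set \<Rightarrow> real) \<Rightarrow> 'v set set set \<Rightarrow> real" where
  "total w \<A> = (\<Sum>T\<in>trees \<inter> \<A>. \<Prod>e\<in>T. w e)"

text \<open>Divided by \<open>total w UNIV\<close>, this is the voltage at \<open>v\<close>, relative to \<open>Min f\<close>, when
  a unit current enters at \<open>Max f\<close>, leaves at \<open>Min f\<close>, and \<open>w\<close> gives the conductances.\<close>
definition potential :: "('v set \<Rightarrow> real) \<Rightarrow> 'v set \<Rightarrow> 'v \<Rightarrow> real" where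
  "potential w f v = (\<Sum>F\<in>forests f. (\<Prod>e\<in>F. w e) * side F (Max f) v)"

lemma edge_Min_Max:
  assumes "e \<in> E"
  shows "{Min e, Max e} = e" "Min e \<in> V" "Max e \<in> V" "Min e < Max e"
proof -
  obtain x y where "x \<in> V" "y \<in> V" "x < y" "e = {x, y}"
    using edge_ex[OF assms] by blast
  then show "{Min e, Max e} = e" "Min e \<in> V" "Max e \<in> V" "Min e < Max e"
    by (auto simp: min_def max_def)
qed

text \<open>A tree as a minimal connected edge set. In this form, exchanging an edge of a tree requires
  reasoning about connectivity only, and no manipulation of cycles.\<close>
lemma tree_iff:
  "T \<in> trees \<longleftrightarrow> T \<subseteq> E \<and> connects V T \<and>
     (\<forall>e\<in>T. (Min e, Max e) \<notin> linked (T - {e}))" (is "_ \<longleftrightarrow> ?R")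
proof
  assume "T \<in> trees"
  then have T: "T \<subseteq> E" "connects V T" "\<not> has_cycle T"
    by (auto simp: trees_def is_spanning_tree_def)
  have "(Min e, Max e) \<notin> linked (T - {e})" if "e \<in> T" for e
  proof -
    have e: "{Min e, Max e} = e" "Min e < Max e" using edge_Min_Max T that by blast+
    show ?thesis using linked_imp_has_cycle[of "Min e" "Max e" T] T(3) that by (auto simp: e(1) less_imp_neq[OF e(2)])
  qed
  then show ?R using T by blast
next
  assume R: ?R
  have "\<not> has_cycle T"
  proof
    assume "has_cycle T"
    then obtain x y where xy: "{x, y} \<in> T" "(x, y) \<in> linked (T - {{x, y}})"
      by (rule has_cycle_imp_linked)
    then have "{Min {x, y}, Max {x, y}} = {x, y}" using R edge_Min_Max(1) by blast
    then have "x = Min {x, y} \<and> y = Max {x, y} \<or> x = Max {x, y} \<and> y = Min {x, y}"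
      by (metis doubleton_eq_iff)
    then show False using R xy linked_sym by metis
  qed
  then show "T \<in> trees" using R by (auto simp: trees_def is_spanning_tree_def)
qed

lemma finite_tree: "T \<in> trees \<Longrightarrow> finite T"
  using finite_subset[OF _ finite_E] by (simp add: tree_iff)

lemma finite_trees: "finite trees"
  by (rule finite_subset[of _ "Pow E"]) (auto simp: tree_iff finite_E)

lemma finite_forests: "finite (forests f)"
  by (rule finite_subset[of _ "Pow E"]) (auto simp: forests_def tree_iff finite_E)

lemma forests_iff: "F \<in> forests f \<longleftrightarrow> (\<exists>T\<in>trees. f \<in> T \<and> F = T - {f})"
proof
  assume "F \<in> forests f"
  then show "\<exists>T\<in>trees. f \<in> T \<and> F = T - {f}"
    by (intro bexI[of _ "insert f F"]) (simp_all add: forests_def)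
next
  assume "\<exists>T\<in>trees. f \<in> T \<and> F = T - {f}"
  then obtain T where "T \<in> trees" "f \<in> T" "F = T - {f}" by blast
  then show "F \<in> forests f" by (simp add: forests_def insert_absorb)
qed

lemma
  assumes "F \<in> forests f"
  shows forest_edge: "f \<in> E"
    and forest_subset: "F \<subseteq> E"
    and forest_separates: "(Min f, Max f) \<notin> linked F"
    and forest_linked: "v \<in> V \<Longrightarrow> (v, Min f) \<in> linked F \<or> (v, Max f) \<in> linked F"
proof -
  obtain T where T: "T \<in> trees" "f \<in> T" "F = T - {f}"
    using assms unfolding forests_iff by blast
  show f: "f \<in> E" and "F \<subseteq> E" and "(Min f, Max f) \<notin> linked F"
    using T by (auto simp: tree_iff)
  assume "v \<in> V"
  have "insert {Min f, Max f} F = T"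
    using T edge_Min_Max(1)[OF f] by auto
  then have "(v, Min f) \<in> linked (insert {Min f, Max f} F)"
    using T(1) edge_Min_Max(2)[OF f] \<open>v \<in> V\<close> by (simp add: tree_iff connects_def linked_def)
  from linked_insertD[OF this] show "(v, Min f) \<in> linked F \<or> (v, Max f) \<in> linked F"
    by auto
qed

lemma edge_diff_side_in:
  assumes "e \<in> F" "F \<subseteq> E"
  shows "edge_diff (side F y) e = 0"
proof -
  have "(Min e, Max e) \<in> linked F"
    using assms edge_Min_Max(1)[of e] by (intro linked_edge) auto
  then have "(Max e, y) \<in> linked F \<longleftrightarrow> (Min e, y) \<in> linked F"
    using linked_sym linked_trans by meson
  then show ?thesis by (simp add: edge_diff_def side_def)
qed

lemma edge_diff_side_self:
  assumes "F \<in> forests f"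
  shows "edge_diff (side F (Max f)) f = 1"
  using forest_separates[OF assms] by (simp add: edge_diff_def side_def)

text \<open>A forest with two components that separates the ends of \<open>f\<close> and of \<open>g\<close> becomes a tree by
  adding either edge. The roles of \<open>f\<close> and \<open>g\<close> in the orientations can be exchanged because both differences
  compare the component of \<open>Max f\<close> with that of \<open>Max g\<close>. This symmetry is the bijection behind
  Kirchhoff's law.\<close>
lemma forest_exchange:
  assumes F: "F \<in> forests f" and g: "g \<in> E"
    and diff: "edge_diff (side F (Max f)) g \<noteq> 0"
  shows "F \<in> forests g" "edge_diff (side F (Max g)) f = edge_diff (side F (Max f)) g"
proof -
  let ?a = "Min g" and ?b = "Max g" and ?x = "Min f" and ?y = "Max f"
  note FE = forest_subset[OF F]
  note sep = forest_separates[OF F]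
  have gF: "g \<notin> F" using edge_diff_side_in FE diff by blast
  have ab: "?a \<in> V" "?b \<in> V" "{?a, ?b} = g" using edge_Min_Max[OF g] by blast+
  have xy: "?x \<in> V" "?y \<in> V" "{?x, ?y} = f" using edge_Min_Max[OF forest_edge[OF F]] by blast+
  have cases: "(?a, ?x) \<in> linked F \<and> (?b, ?y) \<in> linked F \<or> (?a, ?y) \<in> linked F \<and> (?b, ?x) \<in> linked F"
    using diff forest_linked[OF F ab(1)] forest_linked[OF F ab(2)]
    by (auto simp: edge_diff_def side_def split: if_splits)
  have absep: "(?a, ?b) \<notin> linked F"
    using cases sep linked_sym linked_trans by meson
  have T: "insert f F \<in> trees" "f \<notin> F" using F by (auto simp: forests_def)
  have "insert g F \<in> trees"
    unfolding tree_iff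
  proof (intro conjI ballI)
    show "insert g F \<subseteq> E" using FE g by blast
    have F_sub: "(u, v) \<in> linked (insert g F)" if "(u, v) \<in> linked F" for u v
      using linked_mono[of F "insert g F"] that by blast
    have "(?a, ?b) \<in> linked (insert g F)" by (intro linked_edge) (simp add: ab(3))
    then have xy': "(?x, ?y) \<in> linked (insert g F)"
      using cases F_sub linked_sym linked_trans by meson
    have "(v, ?x) \<in> linked (insert g F)" if "v \<in> V" for v
      using forest_linked[OF F that] xy' F_sub linked_sym linked_trans by meson
    then show "connects V (insert g F)"
      unfolding connects_def linked_def[symmetric] using linked_sym linked_trans by meson
  next
    fix h assume h: "h \<in> insert g F"
    show "(Min h, Max h) \<notin> linked (insert g F - {h})"
    proof (cases "h = g")
      case True
      then show ?thesis using absep gF by simp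
    next
      case False
      then have hF: "h \<in> F" and eq: "insert g F - {h} = insert {?a, ?b} (F - {h})"
        using h unfolding ab(3) by auto
      have hsep: "(Min h, Max h) \<notin> linked (F - {h})"
      proof
        assume "(Min h, Max h) \<in> linked (F - {h})"
        then have "(Min h, Max h) \<in> linked (insert f F - {h})"
          by (rule linked_mono[rotated]) auto
        then show False using T hF by (auto simp: tree_iff)
      qed
      have hE: "(Min h, Max h) \<in> linked F"
        using hF FE edge_Min_Max(1)[of h] by (intro linked_edge) auto
      show ?thesis
      proof
        assume "(Min h, Max h) \<in> linked (insert g F - {h})"
        then have "(Min h, ?a) \<in> linked (F - {h}) \<and> (?b, Max h) \<in> linked (F - {h}) \<or>
            (Min h, ?b) \<in> linked (F - {h}) \<and> (?a, Max h) \<in> linked (F - {h})"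
          using linked_insertD hsep unfolding eq by metis
        then have "(Min h, ?a) \<in> linked F \<and> (?b, Max h) \<in> linked F \<or>
            (Min h, ?b) \<in> linked F \<and> (?a, Max h) \<in> linked F"
          using linked_mono[of "F - {h}" F] by blast
        then show False using absep hE linked_sym linked_trans by meson
      qed
    qed
  qed
  then show "F \<in> forests g" using gF by (simp add: forests_def)
  have "(?y, ?x) \<notin> linked F" using sep linked_sym by meson
  have iff: "(?x, ?b) \<in> linked F \<longleftrightarrow> (?b, ?x) \<in> linked F" "(?y, ?b) \<in> linked F \<longleftrightarrow> (?b, ?y) \<in> linked F"
    using linked_sym by metis+
  have one: "\<not> ((v, ?x) \<in> linked F \<and> (v, ?y) \<in> linked F)" for v
    using sep linked_sym linked_trans by meson
  show "edge_diff (side F ?b) f = edge_diff (side F ?y) g"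
    using cases one[of ?a] one[of ?b] by (auto simp: edge_diff_def side_def iff)
qed

text \<open>The coefficient of \<open>g\<close> is the signed number of times the path from \<open>a\<close> to \<open>b\<close> in \<open>T\<close>
  crosses \<open>g\<close>, so the sum telescopes along this path. Expressing the crossing number by
  the component of \<open>T - {g}\<close> makes it additive, and an arbitrary walk can be followed edge by edge.\<close>
lemma tree_path_sum:
  assumes T: "T \<in> trees" and "(a, b) \<in> linked T"
  shows "(\<Sum>g\<in>T. (side (T - {g}) (Max g) b - side (T - {g}) (Max g) a) * edge_diff \<theta> g) = \<theta> b - \<theta> a"
  using assms(2)[unfolded linked_def]
proof (induction rule: rtrancl_induct)
  case base
  then show ?case by simp
next
  case (step b b')
  let ?s = "\<lambda>g v. side (T - {g}) (Max g) v"
  define h where "h = {b, b'}"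
  have h: "h \<in> T" using step.hyps by (simp add: h_def)
  have TE: "T \<subseteq> E" using T by (simp add: tree_iff)
  have hF: "T - {h} \<in> forests h" using h T unfolding forests_iff by blast
  have "(?s g b' - ?s g b) * edge_diff \<theta> g = (if g = h then \<theta> b' - \<theta> b else 0)" if "g \<in> T" for g
  proof (cases "g = h")
    case False
    then have "(b, b') \<in> linked (T - {g})" using h by (intro linked_edge) (auto simp: h_def)
    then have "(b', Max g) \<in> linked (T - {g}) \<longleftrightarrow> (b, Max g) \<in> linked (T - {g})"
      using linked_sym linked_trans by meson
    then have "?s g b' = ?s g b" by (simp add: side_def)
    then show ?thesis using False by simp
  next
    case True
    have "{Min h, Max h} = h" using edge_Min_Max(1) h TE by blast
    then have "b = Min h \<and> b' = Max h \<or> b = Max h \<and> b' = Min h"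
      unfolding h_def by (metis doubleton_eq_iff)
    moreover have "?s h (Max h) = 1" "?s h (Min h) = 0"
      using forest_separates[OF hF] by (auto simp: side_def)
    ultimately show ?thesis using True by (auto simp: edge_diff_def)
  qed
  then have "(\<Sum>g\<in>T. (?s g b' - ?s g b) * edge_diff \<theta> g) = \<theta> b' - \<theta> b"
    using h finite_tree[OF T] by simp
  then show ?case using step.IH by (simp add: algebra_simps sum.distrib sum_subtractf)
qed

lemma edge_diff_potential:
  "edge_diff (potential w f) g =
     (\<Sum>F\<in>forests f. (\<Prod>e\<in>F. w e) * edge_diff (side F (Max f)) g)"
  by (simp add: potential_def edge_diff_def sum_subtractf algebra_simps)

text \<open>Kirchhoff's node law for the potential, tested against \<open>\<theta>\<close>: taking \<open>\<theta>\<close> to be the indicator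
  of a vertex set gives the current that leaves the set. A pair of a forest \<open>F\<close> in \<open>forests f\<close> and an
  edge \<open>g\<close> that joins its components corresponds to the tree \<open>insert g F\<close> together with its edge \<open>g\<close>, on the path
  between the ends of \<open>f\<close>. Grouping the pairs by trees leaves one telescoping sum for each tree.\<close>
theorem weak_Kirchhoff:
  assumes f: "f \<in> E"
  shows "(\<Sum>g\<in>E. w g * edge_diff (potential w f) g * edge_diff \<theta> g) = total w UNIV * edge_diff \<theta> f"
proof -
  let ?S = "{(g, F). g \<in> E \<and> F \<in> forests f \<and> edge_diff (side F (Max f)) g \<noteq> 0}"
  let ?S' = "{(g, T). T \<in> trees \<and> g \<in> T \<and> edge_diff (side (T - {g}) (Max g)) f \<noteq> 0}"
  have "(\<Sum>g\<in>E. w g * edge_diff (potential w f) g * edge_diff \<theta> g) =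
      (\<Sum>(g, F)\<in>E \<times> forests f. w g * (\<Prod>e\<in>F. w e) * edge_diff (side F (Max f)) g * edge_diff \<theta> g)"
    by (simp add: edge_diff_potential sum_distrib_left sum_distrib_right sum.cartesian_product mult.assoc)
  also have "\<dots> = (\<Sum>(g, F)\<in>?S. w g * (\<Prod>e\<in>F. w e) * edge_diff (side F (Max f)) g * edge_diff \<theta> g)"
    by (rule sum.mono_neutral_right) (auto simp: finite_E finite_forests)
  also have "\<dots> = (\<Sum>(g, T)\<in>?S'. (\<Prod>e\<in>T. w e) * edge_diff (side (T - {g}) (Max g)) f * edge_diff \<theta> g)"
  proof (rule sum.reindex_bij_witness[of _ "\<lambda>(g, T). (g, T - {g})" "\<lambda>(g, F). (g, insert g F)"], goal_cases)
    case (1 x)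
    then obtain g F where x: "x = (g, F)" "g \<in> E" "F \<in> forests f" "edge_diff (side F (Max f)) g \<noteq> 0"
      by auto
    from forest_exchange(1)[OF x(3,2,4)] have "g \<notin> F" by (simp add: forests_def)
    then show ?case using x by simp
  next
    case (2 x)
    then obtain g F where x: "x = (g, F)" "g \<in> E" "F \<in> forests f" "edge_diff (side F (Max f)) g \<noteq> 0"
      by auto
    from forest_exchange[OF x(3,2,4)] show ?case
      using x by (simp add: forests_def)
  next
    case (3 x)
    then show ?case by (auto simp: insert_absorb)
  next
    case (4 x)
    then obtain g T where x: "x = (g, T)" "T \<in> trees" "g \<in> T" "edge_diff (side (T - {g}) (Max g)) f \<noteq> 0"
      by auto
    from x(2,3) have F: "T - {g} \<in> forests g" unfolding forests_iff by blast
    from forest_exchange[OF F f x(4)] show ?case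
      using x forest_edge[OF F] by simp
  next
    case (5 x)
    then obtain g F where x: "x = (g, F)" "g \<in> E" "F \<in> forests f" "edge_diff (side F (Max f)) g \<noteq> 0"
      by auto
    note ex = forest_exchange[OF x(3,2,4)]
    have "g \<notin> F" using ex by (simp add: forests_def)
    moreover have "finite F" using forest_subset[OF x(3)] finite_E finite_subset by blast
    ultimately show ?case using x ex(2) by simp
  qed
  also have "\<dots> = (\<Sum>(g, T)\<in>(\<lambda>(T, g). (g, T)) ` (SIGMA T:trees. T).
      (\<Prod>e\<in>T. w e) * edge_diff (side (T - {g}) (Max g)) f * edge_diff \<theta> g)"
    by (rule sum.mono_neutral_left) (auto simp: finite_trees finite_tree)
  also have "\<dots> = (\<Sum>(T, g)\<in>(SIGMA T:trees. T).
      (\<Prod>e\<in>T. w e) * edge_diff (side (T - {g}) (Max g)) f * edge_diff \<theta> g)"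
    by (subst sum.reindex) (auto simp: inj_on_def split_def)
  also have "\<dots> = (\<Sum>T\<in>trees. \<Sum>g\<in>T. (\<Prod>e\<in>T. w e) * edge_diff (side (T - {g}) (Max g)) f * edge_diff \<theta> g)"
    by (rule sum.Sigma[symmetric]) (auto simp: finite_trees finite_tree)
  also have "\<dots> = (\<Sum>T\<in>trees. (\<Prod>e\<in>T. w e) * edge_diff \<theta> f)"
  proof (rule sum.cong[OF refl])
    fix T assume T: "T \<in> trees"
    have "(Min f, Max f) \<in> linked T"
      using T edge_Min_Max(2,3)[OF f] by (auto simp: tree_iff connects_def linked_def)
    from tree_path_sum[OF T this, of \<theta>]
    show "(\<Sum>g\<in>T. (\<Prod>e\<in>T. w e) * edge_diff (side (T - {g}) (Max g)) f * edge_diff \<theta> g) =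
        (\<Prod>e\<in>T. w e) * edge_diff \<theta> f"
      by (simp add: edge_diff_def[of _ f] sum_distrib_left[symmetric] mult.assoc)
  qed
  also have "\<dots> = total w UNIV * edge_diff \<theta> f"
    by (simp add: total_def sum_distrib_right)
  finally show ?thesis .
qed

lemma total_edge:
  assumes "f \<in> E"
  shows "total w {T. f \<in> T} = w f * edge_diff (potential w f) f"
proof -
  have "edge_diff (potential w f) f = (\<Sum>F\<in>forests f. \<Prod>e\<in>F. w e)"
    by (auto simp: edge_diff_potential edge_diff_side_self intro!: sum.cong)
  also have "w f * \<dots> = (\<Sum>F\<in>forests f. \<Prod>e\<in>insert f F. w e)"
    unfolding sum_distrib_left
  proof (rule sum.cong[OF refl])
    fix F assume F: "F \<in> forests f"
    have "finite F" using forest_subset[OF F] finite_E finite_subset by blast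
    then show "w f * (\<Prod>e\<in>F. w e) = (\<Prod>e\<in>insert f F. w e)"
      using F by (simp add: forests_def)
  qed
  also have "\<dots> = total w {T. f \<in> T}"
    unfolding total_def
    by (rule sum.reindex_bij_witness[of _ "\<lambda>T. T - {f}" "insert f"])
      (auto simp: forests_def insert_absorb)
  finally show ?thesis by simp
qed

lemma total_delete:
  "total (w(e := 0)) \<A> = total w \<A> - total w (\<A> \<inter> {T. e \<in> T})"
proof -
  have "total w \<A> - total w (\<A> \<inter> {T. e \<in> T}) = total w (\<A> - {T. e \<in> T})"
    unfolding total_def using finite_trees
    by (subst sum_diff[symmetric]) (auto intro!: sum.cong)
  also have "\<dots> = total (w(e := 0)) (\<A> - {T. e \<in> T})"
    unfolding total_def by (intro sum.cong prod.cong) auto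
  also have "\<dots> = total (w(e := 0)) \<A>"
    unfolding total_def
    by (rule sum.mono_neutral_left) (auto simp: finite_trees finite_tree intro!: prod_zero)
  finally show ?thesis by simp
qed

text \<open>Divided by the square of the total weight, this says that the covariance of two edges is
  minus the product of their weights with the squared voltage drop along one of them caused by a unit
  current between the ends of the other. The proof compares the network with the one in which \<open>e\<close> has weight \<open>0\<close>: both
  potentials are inserted in both energy forms, which differ in the term of \<open>e\<close> only. The potential
  difference along \<open>e\<close> is the same in both networks, because the forests that contribute to it
  do not contain \<open>e\<close>.\<close>
theorem two_edges:
  assumes e: "e \<in> E" and f: "f \<in> E" and ne: "e \<noteq> f"
  shows "total w {T. e \<in> T} * total w {T. f \<in> T} - total w UNIV * total w {T. e \<in> T \<and> f \<in> T} =
    w e * w f * (edge_diff (potential w f) e)\<^sup>2"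
proof -
  define w0 where "w0 = w(e := 0)"
  define \<phi> where "\<phi> = potential w f"
  define \<phi>0 where "\<phi>0 = potential w0 f"
  have 1: "(\<Sum>g\<in>E. w g * edge_diff \<phi> g * edge_diff \<phi>0 g) = total w UNIV * edge_diff \<phi>0 f"
    unfolding \<phi>_def by (rule weak_Kirchhoff[OF f])
  have 2: "(\<Sum>g\<in>E. w0 g * edge_diff \<phi>0 g * edge_diff \<phi> g) = total w0 UNIV * edge_diff \<phi> f"
    unfolding \<phi>0_def by (rule weak_Kirchhoff[OF f])
  have "total w UNIV * edge_diff \<phi>0 f - total w0 UNIV * edge_diff \<phi> f =
      (\<Sum>g\<in>E. if g = e then w e * edge_diff \<phi> e * edge_diff \<phi>0 e else 0)"
    unfolding 1[symmetric] 2[symmetric] sum_subtractf[symmetric]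
    by (rule sum.cong) (auto simp: w0_def)
  also have "\<dots> = w e * edge_diff \<phi> e * edge_diff \<phi>0 e"
    using finite_E e by simp
  also have "edge_diff \<phi>0 e = edge_diff \<phi> e"
    unfolding \<phi>_def \<phi>0_def edge_diff_potential
  proof (rule sum.cong[OF refl])
    fix F assume F: "F \<in> forests f"
    show "(\<Prod>e\<in>F. w0 e) * edge_diff (side F (Max f)) e = (\<Prod>e\<in>F. w e) * edge_diff (side F (Max f)) e"
    proof (cases "e \<in> F")
      case True
      then show ?thesis using edge_diff_side_in forest_subset[OF F] by simp
    next
      case False
      then have "(\<Prod>e\<in>F. w0 e) = (\<Prod>e\<in>F. w e)"
        by (intro prod.cong) (auto simp: w0_def)
      then show ?thesis by simp
    qed
  qed
  finally have *: "total w UNIV * edge_diff \<phi>0 f - total w0 UNIV * edge_diff \<phi> f =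
      w e * (edge_diff \<phi> e)\<^sup>2" by (simp add: power2_eq_square mult.assoc)
  have w0f: "w0 f = w f" using ne by (simp add: w0_def)
  have "w e * w f * (edge_diff \<phi> e)\<^sup>2 =
      total w UNIV * (w0 f * edge_diff \<phi>0 f) - total w0 UNIV * (w f * edge_diff \<phi> f)"
    unfolding w0f using arg_cong[OF *, of "\<lambda>x. w f * x"] by (simp add: algebra_simps)
  also have "\<dots> = total w UNIV * total w0 {T. f \<in> T} - total w0 UNIV * total w {T. f \<in> T}"
    unfolding \<phi>_def \<phi>0_def by (simp add: total_edge[OF f])
  also have "\<dots> = total w {T. e \<in> T} * total w {T. f \<in> T} -
      total w UNIV * total w {T. e \<in> T \<and> f \<in> T}"
    unfolding w0_def total_delete
    by (simp add: Int_def algebra_simps conj_commute)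
  finally show ?thesis by (simp add: \<phi>_def)
qed

end

section \<open>Voltages on the helix\<close>

lemma Max_Min_helix_edges [simp]:
  "Max (z_edge m) = m" "Min (z_edge m) = m - 1"
  "Max (g_edge m) = m" "Min (g_edge m) = m - 2"
  "Max (h_edge m) = m" "Min (h_edge m) = m - 3"
  by (simp_all add: z_edge_def g_edge_def h_edge_def max_def min_def)

lemma helix_edge_eq_iff [simp]:
  "z_edge i = z_edge j \<longleftrightarrow> i = j" "g_edge i = g_edge j \<longleftrightarrow> i = j" "h_edge i = h_edge j \<longleftrightarrow> i = j"
  by (metis Max_Min_helix_edges)+

lemma helix_edge_neq [simp]:
  "z_edge i \<noteq> g_edge j" "g_edge j \<noteq> z_edge i" "z_edge i \<noteq> h_edge j" "h_edge j \<noteq> z_edge i"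
  "g_edge i \<noteq> h_edge j" "h_edge j \<noteq> g_edge i"
proof -
  have 1: "False" if "z_edge i = g_edge j"
    using arg_cong[OF that, of Max] arg_cong[OF that, of Min] by simp
  have 2: "False" if "z_edge i = h_edge j"
    using arg_cong[OF that, of Max] arg_cong[OF that, of Min] by simp
  have 3: "False" if "g_edge i = h_edge j"
    using arg_cong[OF that, of Max] arg_cong[OF that, of Min] by simp
  show "z_edge i \<noteq> g_edge j" "g_edge j \<noteq> z_edge i" "z_edge i \<noteq> h_edge j" "h_edge j \<noteq> z_edge i"
    "g_edge i \<noteq> h_edge j" "h_edge j \<noteq> g_edge i"
    using 1 2 3 by metis+
qed

lemma edge_weight_simps [simp]:
  "edge_weight c d (z_edge m) = c" "edge_weight c d (g_edge m) = d" "edge_weight c d (h_edge m) = 1"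
  by (auto simp: edge_weight_def)

definition helix_box :: "nat \<Rightarrow> int set set" where
  "helix_box n = {e \<in> helix_edges. e \<subseteq> {- int n..int n}}"

lemma z_edge_in_box: "z_edge m \<in> helix_box n \<longleftrightarrow> - int n < m \<and> m \<le> int n"
  by (auto simp: helix_box_def helix_edges_def z_edge_def)

lemma g_edge_in_box: "g_edge m \<in> helix_box n \<longleftrightarrow> 1 - int n < m \<and> m \<le> int n"
  by (auto simp: helix_box_def helix_edges_def g_edge_def)

lemma h_edge_in_box: "h_edge m \<in> helix_box n \<longleftrightarrow> 2 - int n < m \<and> m \<le> int n"
  by (auto simp: helix_box_def helix_edges_def h_edge_def)

interpretation helix: finite_graph "{- int n..int n}" "helix_box n" for n
proof
  show "finite (helix_box n)"
    by (rule finite_subset[of _ "Pow {- int n..int n}"]) (auto simp: helix_box_def)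
  fix e assume "e \<in> helix_box n"
  then obtain m k where "e = {m - k, m}" "0 < k" "e \<subseteq> {- int n..int n}"
    by (force simp: helix_box_def helix_edges_def z_edge_def g_edge_def h_edge_def)
  then show "\<exists>x\<in>{- int n..int n}. \<exists>y\<in>{- int n..int n}. x < y \<and> e = {x, y}"
    by (intro bexI[of _ "m - k"] bexI[of _ m]) auto
qed

lemma finite_tree_prob_eq:
  "finite_tree_prob c d n \<A> =
     helix.total n (edge_weight c d) \<A> / helix.total n (edge_weight c d) UNIV"
  unfolding finite_tree_prob_def finite_trees_def helix.total_def helix.trees_def
    tree_weight_def helix_box_def[symmetric] by simp

definition voltage :: "real \<Rightarrow> real \<Rightarrow> nat \<Rightarrow> int \<Rightarrow> real" where
  "voltage c d n v =
     helix.potential n (edge_weight c d) (z_edge 0) v / helix.total n (edge_weight c d) UNIV"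

text \<open>The drop along \<open>z_edge m\<close> in the box of size \<open>n\<close>, for a unit current between the ends of
  \<open>z_edge 0\<close>.\<close>
definition vdrop :: "real \<Rightarrow> real \<Rightarrow> nat \<Rightarrow> int \<Rightarrow> real" where
  "vdrop c d n m = voltage c d n m - voltage c d n (m - 1)"

lemma edge_diff_voltage:
  "edge_diff (voltage c d n) e =
     edge_diff (helix.potential n (edge_weight c d) (z_edge 0)) e / helix.total n (edge_weight c d) UNIV"
  by (simp add: edge_diff_def voltage_def diff_divide_distrib)

lemma voltage_Kirchhoff:
  assumes "helix.total n (edge_weight c d) UNIV \<noteq> 0" and "1 \<le> n"
  shows "(\<Sum>g\<in>helix_box n. edge_weight c d g * edge_diff (voltage c d n) g * edge_diff \<theta> g) =
    \<theta> 0 - \<theta> (-1)"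
proof -
  have "z_edge 0 \<in> helix_box n" using assms(2) by (simp add: z_edge_in_box)
  from helix.weak_Kirchhoff[OF this, of "edge_weight c d" \<theta>] show ?thesis
    using assms(1) unfolding edge_diff_voltage
    by (simp add: sum_divide_distrib[symmetric] edge_diff_def[of \<theta> "z_edge 0"] field_simps)
qed

text \<open>The node law summed over all vertices \<open>v \<ge> m\<close>. Six edges cross the cut between \<open>m - 1\<close> and
  \<open>m\<close>, and each voltage drop along one of them is a sum of drops along consecutive z-edges. The
  source and the sink of the current are both on the left of the cut.\<close>
lemma vdrop_recurrence:
  fixes m :: int
  assumes tot: "helix.total n (edge_weight c d) UNIV \<noteq> 0" and m: "1 \<le> m" "m + 2 \<le> int n"
  defines "y \<equiv> vdrop c d n"
  shows "(2 + d) * (y (m + 1) + y (m - 1)) = - (y (m + 2) + (3 + 2 * d + c) * y m + y (m - 2))"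
proof -
  let ?u = "voltage c d n"
  \<comment> \<open>Testing against the indicator of the right side keeps only the edges across the cut.\<close>
  define \<theta> :: "int \<Rightarrow> real" where "\<theta> v = of_bool (m \<le> v)" for v
  let ?C = "{z_edge m, g_edge m, g_edge (m + 1), h_edge m, h_edge (m + 1), h_edge (m + 2)}"
  have n: "1 \<le> n" using m by simp
  have "0 = (\<Sum>g\<in>helix_box n. edge_weight c d g * edge_diff ?u g * edge_diff \<theta> g)"
    using voltage_Kirchhoff[OF tot n, of \<theta>] m by (simp add: \<theta>_def)
  also have "\<dots> = (\<Sum>g\<in>?C. edge_weight c d g * edge_diff ?u g * edge_diff \<theta> g)"
  proof (rule sum.mono_neutral_right[OF helix.finite_E])
    show "?C \<subseteq> helix_box n"
      using m by (simp add: z_edge_in_box g_edge_in_box h_edge_in_box)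
    have "edge_diff \<theta> e = 0" if "e \<in> helix_box n" "e \<notin> ?C" for e
    proof -
      consider k where "e = z_edge k" "k \<noteq> m" | k where "e = g_edge k" "k \<noteq> m" "k \<noteq> m + 1"
        | k where "e = h_edge k" "k \<noteq> m" "k \<noteq> m + 1" "k \<noteq> m + 2"
        using \<open>e \<in> helix_box n\<close> \<open>e \<notin> ?C\<close> unfolding helix_box_def helix_edges_def by auto
      then show ?thesis by cases (auto simp: edge_diff_def \<theta>_def)
    qed
    then show "\<forall>e\<in>helix_box n - ?C. edge_weight c d e * edge_diff ?u e * edge_diff \<theta> e = 0"
      by simp
  qed
  also have "\<dots> = c * (?u m - ?u (m - 1)) + d * (?u m - ?u (m - 2)) + d * (?u (m + 1) - ?u (m - 1)) +
      (?u m - ?u (m - 3)) + (?u (m + 1) - ?u (m - 2)) + (?u (m + 2) - ?u (m - 1))"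
    by (simp add: edge_diff_def \<theta>_def)
  finally show ?thesis
    by (simp add: y_def vdrop_def algebra_simps)
qed

text \<open>The node law tested against the voltage itself gives the total energy; the even z-edges are
  some of its nonnegative terms.\<close>
lemma vdrop_energy:
  assumes tot: "helix.total n (edge_weight c d) UNIV \<noteq> 0" and "2 * K < n"
    and "0 < c" "0 \<le> d"
  shows "c * (\<Sum>k<K. (vdrop c d n (2 * int k))\<^sup>2) \<le> vdrop c d n 0"
proof -
  let ?u = "voltage c d n"
  have "c * (\<Sum>k<K. (vdrop c d n (2 * int k))\<^sup>2) =
      (\<Sum>g\<in>(\<lambda>k. z_edge (2 * int k)) ` {..<K}. edge_weight c d g * edge_diff ?u g * edge_diff ?u g)"
    by (subst sum.reindex)
      (auto simp: inj_on_def sum_distrib_left edge_diff_def vdrop_def power2_eq_square mult.assoc)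
  also have "\<dots> \<le> (\<Sum>g\<in>helix_box n. edge_weight c d g * edge_diff ?u g * edge_diff ?u g)"
    using assms
    by (intro sum_mono2 helix.finite_E)
      (auto simp: z_edge_in_box edge_weight_def mult.assoc)
  also have "\<dots> = vdrop c d n 0"
    using voltage_Kirchhoff[OF tot] assms(2) by (simp add: vdrop_def)
  finally show ?thesis .
qed

lemma finite_tree_prob_z_edge:
  assumes "1 \<le> n"
  shows "finite_tree_prob c d n {t. z_edge 0 \<in> t} = c * vdrop c d n 0"
proof -
  have "z_edge 0 \<in> helix_box n" using assms by (simp add: z_edge_in_box)
  from helix.total_edge[OF this, of "edge_weight c d"]
  have "finite_tree_prob c d n {t. z_edge 0 \<in> t} = c * edge_diff (voltage c d n) (z_edge 0)"
    by (simp add: finite_tree_prob_eq edge_diff_voltage)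
  then show ?thesis by (simp add: edge_diff_def vdrop_def)
qed

lemma finite_tree_prob_two_z_edges:
  assumes "helix.total n (edge_weight c d) UNIV \<noteq> 0" and "m \<noteq> 0" "\<bar>m\<bar> < int n"
  shows "finite_tree_prob c d n {t. z_edge m \<in> t} * finite_tree_prob c d n {t. z_edge 0 \<in> t} -
    finite_tree_prob c d n {t. z_edge m \<in> t \<and> z_edge 0 \<in> t} = (c * vdrop c d n m)\<^sup>2"
proof -
  have "z_edge m \<in> helix_box n" "z_edge 0 \<in> helix_box n" "z_edge m \<noteq> z_edge 0"
    using assms by (auto simp: z_edge_in_box)
  from helix.two_edges[OF this, of "edge_weight c d"]
  have "finite_tree_prob c d n {t. z_edge m \<in> t} * finite_tree_prob c d n {t. z_edge 0 \<in> t} -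
    finite_tree_prob c d n {t. z_edge m \<in> t \<and> z_edge 0 \<in> t} =
    (c * edge_diff (voltage c d n) (z_edge m))\<^sup>2"
    using assms(1) by (simp add: finite_tree_prob_eq edge_diff_voltage field_simps power2_eq_square)
  then show ?thesis by (simp add: edge_diff_def vdrop_def)
qed

lemma weighted_random_tree_tendsto:
  assumes "weighted_random_tree c d N T" and "finite I"
  shows "(\<lambda>n. finite_tree_prob c d n {t. z_edge ` I \<subseteq> t})
    \<longlonglongrightarrow> \<P>(\<omega> in N. z_edge ` I \<subseteq> T \<omega>)"
proof -
  let ?F = "z_edge ` I"
  have "finite ?F" "?F \<subseteq> helix_edges" "{?F} \<subseteq> Pow ?F"
    using assms(2) by (auto simp: helix_edges_def)
  then have "(\<lambda>n. finite_tree_prob c d n {t. t \<inter> ?F \<in> {?F}}) \<longlonglongrightarrow> \<P>(\<omega> in N. T \<omega> \<inter> ?F \<in> {?F})"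
    using assms(1) unfolding weighted_random_tree_def by blast
  moreover have "t \<inter> ?F \<in> {?F} \<longleftrightarrow> ?F \<subseteq> t" for t by blast
  ultimately show ?thesis by simp
qed

text \<open>Zero correlation forces the limiting drops along the odd z-edges to vanish. The local recurrence
  then carries the drop at \<open>z_edge 0\<close>, up to sign, to every second edge, which contradicts
  the energy bound, as this bound is uniform in the size of the box.\<close>
theorem helix_odd_lags_uncorrelated:
  assumes "prob_space N" and T: "weighted_random_tree c d N T" and cd: "0 < c" "0 \<le> d"
    and \<alpha>: "\<And>m. \<P>(\<omega> in N. z_edge m \<in> T \<omega>) = \<alpha>"
    and odd: "\<And>m. odd m \<Longrightarrow> \<P>(\<omega> in N. z_edge m \<in> T \<omega> \<and> z_edge 0 \<in> T \<omega>) = \<alpha>\<^sup>2"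
  shows "\<alpha> = 0"
proof (rule ccontr)
  interpret N: prob_space N by fact
  let ?y = "\<lambda>m n. vdrop c d n m"
  assume "\<alpha> \<noteq> 0"
  moreover have "0 \<le> \<alpha>" using \<alpha>[of 0] by (metis measure_nonneg)
  ultimately have pos: "0 < \<alpha>" by simp
  have "(\<lambda>n. finite_tree_prob c d n UNIV) \<longlonglongrightarrow> 1"
    using weighted_random_tree_tendsto[OF T, of "{}"] N.prob_space by simp
  then have "eventually (\<lambda>n. finite_tree_prob c d n UNIV > 0) sequentially"
    by (rule order_tendstoD) simp
  \<comment> \<open>If the total weight were zero, division by zero would assign probability \<open>0\<close> even to the sure event.\<close>
  then have tot: "eventually (\<lambda>n. helix.total n (edge_weight c d) UNIV \<noteq> 0) sequentially"
    by eventually_elim (auto simp: finite_tree_prob_eq)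
  have one: "(\<lambda>n. finite_tree_prob c d n {t. z_edge m \<in> t}) \<longlonglongrightarrow> \<alpha>" for m
    using weighted_random_tree_tendsto[OF T, of "{m}"] \<alpha>[of m] by simp
  have y0: "?y 0 \<longlonglongrightarrow> \<alpha> / c"
  proof -
    have "(\<lambda>n. finite_tree_prob c d n {t. z_edge 0 \<in> t} / c) \<longlonglongrightarrow> \<alpha> / c"
      using one[of 0] by (rule tendsto_divide) (use cd in auto)
    moreover have "eventually (\<lambda>n. finite_tree_prob c d n {t. z_edge 0 \<in> t} / c = ?y 0 n) sequentially"
      using eventually_ge_at_top[of 1]
      by eventually_elim (use cd in \<open>simp add: finite_tree_prob_z_edge\<close>)
    ultimately show ?thesis by (rule Lim_transform_eventually)
  qed
  have y_odd: "?y m \<longlonglongrightarrow> 0" if "odd m" for m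
  proof -
    let ?P = "finite_tree_prob c d"
    have "(\<lambda>n. ?P n {t. z_edge m \<in> t} * ?P n {t. z_edge 0 \<in> t} - ?P n {t. z_edge m \<in> t \<and> z_edge 0 \<in> t})
        \<longlonglongrightarrow> \<alpha> * \<alpha> - \<alpha>\<^sup>2"
      using weighted_random_tree_tendsto[OF T, of "{m, 0}"] odd[OF that]
      by (intro tendsto_diff tendsto_mult one) simp
    then have "(\<lambda>n. ?P n {t. z_edge m \<in> t} * ?P n {t. z_edge 0 \<in> t} - ?P n {t. z_edge m \<in> t \<and> z_edge 0 \<in> t})
        \<longlonglongrightarrow> 0" by (simp add: power2_eq_square)
    moreover have "eventually (\<lambda>n. ?P n {t. z_edge m \<in> t} * ?P n {t. z_edge 0 \<in> t} -
        ?P n {t. z_edge m \<in> t \<and> z_edge 0 \<in> t} = (c * ?y m n)\<^sup>2) sequentially"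
      using tot eventually_gt_at_top[of "nat \<bar>m\<bar>"]
    proof eventually_elim
      case (elim n)
      have "m \<noteq> 0" "\<bar>m\<bar> < int n" using elim that by auto
      with elim(1) show ?case by (rule finite_tree_prob_two_z_edges)
    qed
    ultimately have "(\<lambda>n. (c * ?y m n)\<^sup>2) \<longlonglongrightarrow> 0" by (rule Lim_transform_eventually)
    from tendsto_real_sqrt[OF this] have "(\<lambda>n. \<bar>c * ?y m n\<bar>) \<longlonglongrightarrow> 0" by simp
    then have "(\<lambda>n. c * ?y m n) \<longlonglongrightarrow> 0" by (rule tendsto_rabs_zero_cancel)
    from tendsto_mult_left[OF this, of "1 / c"] show ?thesis using cd by simp
  qed
  \<comment> \<open>In the recurrence at an odd \<open>m\<close>, all terms except those at \<open>m - 1\<close> and \<open>m + 1\<close> tend to \<open>0\<close>.\<close>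
  have y_even: "?y (2 * int k) \<longlonglongrightarrow> (-1) ^ k * (\<alpha> / c)" for k
  proof (induction k)
    case 0
    then show ?case using y0 by simp
  next
    case (Suc k)
    define m where "m = 2 * int k + 1"
    have m: "odd m" "1 \<le> m" by (auto simp: m_def)
    have "(\<lambda>n. - (?y (m + 2) n + (3 + 2 * d + c) * ?y m n + ?y (m - 2) n) / (2 + d) - ?y (2 * int k) n)
        \<longlonglongrightarrow> - (0 + (3 + 2 * d + c) * 0 + 0) / (2 + d) - (-1) ^ k * (\<alpha> / c)"
      by (intro tendsto_intros y_odd Suc.IH) (use m cd in auto)
    moreover have "eventually (\<lambda>n. - (?y (m + 2) n + (3 + 2 * d + c) * ?y m n + ?y (m - 2) n) / (2 + d)
        - ?y (2 * int k) n = ?y (2 * int (Suc k)) n) sequentially"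
      using tot eventually_ge_at_top[of "nat (m + 2)"]
    proof eventually_elim
      case (elim n)
      have "m + 2 \<le> int n" using elim by simp
      from vdrop_recurrence[OF elim(1) m(2) this]
      show ?case using cd by (simp add: m_def field_simps)
    qed
    ultimately have "?y (2 * int (Suc k)) \<longlonglongrightarrow> - (0 + (3 + 2 * d + c) * 0 + 0) / (2 + d) - (-1) ^ k * (\<alpha> / c)"
      by (rule Lim_transform_eventually)
    then show ?case by simp
  qed
  \<comment> \<open>The first \<open>K\<close> even z-edges carry the limiting energy \<open>K \<alpha>\<^sup>2 / c\<close>, out of \<open>\<alpha> / c\<close>.\<close>
  have bound: "real K * \<alpha> \<le> 1" for K
  proof -
    have "(\<lambda>n. c * (\<Sum>k<K. (?y (2 * int k) n)\<^sup>2)) \<longlonglongrightarrow> c * (\<Sum>k<K. ((-1) ^ k * (\<alpha> / c))\<^sup>2)"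
      by (intro tendsto_intros y_even)
    moreover have "eventually (\<lambda>n. c * (\<Sum>k<K. (?y (2 * int k) n)\<^sup>2) \<le> ?y 0 n) sequentially"
      using tot eventually_gt_at_top[of "2 * K"]
      by eventually_elim (use vdrop_energy cd in blast)
    ultimately have "c * (\<Sum>k<K. ((-1) ^ k * (\<alpha> / c))\<^sup>2) \<le> \<alpha> / c"
      using y0 by (intro tendsto_le[OF sequentially_bot])
    moreover have "(\<Sum>k<K. ((-1) ^ k * (\<alpha> / c))\<^sup>2) = (\<Sum>k<K. (\<alpha> / c)\<^sup>2)"
    proof (rule sum.cong[OF refl])
      fix k show "((-1) ^ k * (\<alpha> / c))\<^sup>2 = (\<alpha> / c)\<^sup>2" by (cases "even k") auto
    qed
    ultimately have "c * (real K * (\<alpha> / c)\<^sup>2) \<le> \<alpha> / c" by simp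
    also have "c * (real K * (\<alpha> / c)\<^sup>2) = real K * \<alpha> * (\<alpha> / c)"
      using cd by (simp add: power2_eq_square)
    finally show ?thesis using pos cd by (simp add: field_simps)
  qed
  obtain K :: nat where "1 / \<alpha> < real K" using reals_Archimedean2 by blast
  then show False using bound[of K] pos by (simp add: field_simps)
qed

section \<open>Determinants of block matrices\<close>

lemma det_on_reindex:
  assumes "inj_on f S" "finite S"
  shows "det_on (f ` S) A = det_on S (\<lambda>i j. A (f i) (f j))"
proof -
  have "det_on (f ` S) A = (\<Sum>\<pi> | \<pi> permutes S. of_int (sign (map_permutation S f \<pi>)) *
      (\<Prod>i\<in>f ` S. A i (map_permutation S f \<pi> i)))"
    unfolding det_on_def
    using sum.reindex_bij_betw[OF bij_betw_permutations[OF bij_betw_imageI[OF assms(1) refl]],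
        of "\<lambda>\<pi>. of_int (sign \<pi>) * (\<Prod>i\<in>f ` S. A i (\<pi> i))", symmetric]
    by (simp add: map_permutation_def restrict_id_def)
  also have "\<dots> = det_on S (\<lambda>i j. A (f i) (f j))"
    unfolding det_on_def
  proof (rule sum.cong[OF refl])
    fix \<pi> assume "\<pi> \<in> {\<pi>. \<pi> permutes S}"
    then have \<pi>: "\<pi> permutes S" by simp
    have "(\<Prod>i\<in>f ` S. A i (map_permutation S f \<pi> i)) = (\<Prod>i\<in>S. A (f i) (f (\<pi> i)))"
      using assms by (simp add: prod.reindex map_permutation_apply)
    then show "of_int (sign (map_permutation S f \<pi>)) * (\<Prod>i\<in>f ` S. A i (map_permutation S f \<pi> i)) =
        of_int (sign \<pi>) * (\<Prod>i\<in>S. A (f i) (f (\<pi> i)))"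
      using sign_map_permutation[OF assms(1) \<pi> assms(2)] by simp
  qed
  finally show ?thesis .
qed

text \<open>A permutation that contributes to the determinant cannot map a point of \<open>S\<close> into \<open>R\<close>, so it
  preserves both sets and is a product of a permutation of \<open>S\<close> and one of \<open>R\<close>.\<close>
lemma det_on_block:
  fixes A :: "'i \<Rightarrow> 'i \<Rightarrow> 'b :: comm_ring_1"
  assumes fin: "finite S" "finite R" and disj: "S \<inter> R = {}"
    and zero: "\<And>i j. i \<in> S \<Longrightarrow> j \<in> R \<Longrightarrow> A i j = 0"
  shows "det_on (S \<union> R) A = det_on S A * det_on R A"
proof -
  let ?t = "\<lambda>U \<pi>. of_int (sign \<pi>) * (\<Prod>i\<in>U. A i (\<pi> i))"
  let ?B = "{\<pi>. \<pi> permutes S \<union> R \<and> \<pi> ` S = S}"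
  have perm: "restrict_id \<pi> S permutes S" "restrict_id \<pi> R permutes R" if "\<pi> \<in> ?B" for \<pi>
  proof -
    have inj: "inj \<pi>" using that permutes_inj by auto
    have "\<pi> ` (S \<union> R) = S \<union> R" using that permutes_image by auto
    then have "\<pi> ` R = R"
      using that disj image_Int[OF inj, of S R] by (auto simp: image_Un)
    then show "restrict_id \<pi> S permutes S" "restrict_id \<pi> R permutes R"
      using that by (auto intro!: permutes_restrict_id inj_on_imp_bij_betw inj_on_subset[OF inj] simp: bij_betw_def)
  qed
  have out: "\<sigma> i = i" if "\<sigma> permutes S" "i \<in> R" for \<sigma> i
    using that disj by (auto intro: permutes_not_in)
  have out': "\<rho> i = i" if "\<rho> permutes R" "i \<in> S" for \<rho> i
    using that disj by (auto intro: permutes_not_in)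
  have "det_on (S \<union> R) A = sum (?t (S \<union> R)) ?B"
    unfolding det_on_def
  proof (rule sum.mono_neutral_right)
    show "finite {\<pi>. \<pi> permutes S \<union> R}" using fin by (simp add: finite_permutations)
    have "?t (S \<union> R) \<pi> = 0" if \<pi>: "\<pi> permutes S \<union> R" "\<pi> ` S \<noteq> S" for \<pi>
    proof -
      have "\<not> \<pi> ` S \<subseteq> S"
        using \<pi> fin(1) endo_inj_surj[of S \<pi>] inj_on_subset[OF permutes_inj] by blast
      then obtain i where i: "i \<in> S" "\<pi> i \<notin> S" by blast
      moreover have "\<pi> i \<in> S \<union> R" using i(1) permutes_in_image[OF \<pi>(1)] by blast
      ultimately have "A i (\<pi> i) = 0" using zero by blast
      then have "(\<Prod>i\<in>S \<union> R. A i (\<pi> i)) = 0" using i fin by (intro prod_zero) auto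
      then show ?thesis by simp
    qed
    then show "\<forall>\<pi>\<in>{\<pi>. \<pi> permutes S \<union> R} - ?B. ?t (S \<union> R) \<pi> = 0" by auto
  qed auto
  also have "\<dots> = (\<Sum>(\<sigma>, \<rho>)\<in>{\<sigma>. \<sigma> permutes S} \<times> {\<rho>. \<rho> permutes R}. ?t S \<sigma> * ?t R \<rho>)"
  proof (rule sum.reindex_bij_witness[of _ "\<lambda>(\<sigma>, \<rho>). \<sigma> \<circ> \<rho>" "\<lambda>\<pi>. (restrict_id \<pi> S, restrict_id \<pi> R)"])
    fix \<pi> assume \<pi>: "\<pi> \<in> ?B"
    then have sub: "\<pi> permutes S \<union> R" by simp
    have inv: "\<pi> i \<in> R" if "i \<in> R" for i
      using permutes_in_image[OF perm(2)[OF \<pi>], of i] that by simp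
    have eq: "restrict_id \<pi> S \<circ> restrict_id \<pi> R = \<pi>"
      using inv disj permutes_not_in[OF sub] by (fastforce simp: restrict_id_def)
    then show "(case (restrict_id \<pi> S, restrict_id \<pi> R) of (\<sigma>, \<rho>) \<Rightarrow> \<sigma> \<circ> \<rho>) = \<pi>" by simp
    show "(restrict_id \<pi> S, restrict_id \<pi> R) \<in> {\<sigma>. \<sigma> permutes S} \<times> {\<rho>. \<rho> permutes R}"
      using perm[OF \<pi>] by simp
    have "sign \<pi> = sign (restrict_id \<pi> S) * sign (restrict_id \<pi> R)"
      using perm[OF \<pi>] fin eq sign_compose permutation_permutes by metis
    moreover have "(\<Prod>i\<in>S \<union> R. A i (\<pi> i)) = (\<Prod>i\<in>S. A i (\<pi> i)) * (\<Prod>i\<in>R. A i (\<pi> i))"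
      using fin disj by (rule prod.union_disjoint)
    ultimately show "(case (restrict_id \<pi> S, restrict_id \<pi> R) of (\<sigma>, \<rho>) \<Rightarrow> ?t S \<sigma> * ?t R \<rho>) = ?t (S \<union> R) \<pi>"
      by (simp add: mult_ac)
  next
    fix x assume "x \<in> {\<sigma>. \<sigma> permutes S} \<times> {\<rho>. \<rho> permutes R}"
    then obtain \<sigma> \<rho> where x: "x = (\<sigma>, \<rho>)" "\<sigma> permutes S" "\<rho> permutes R" by auto
    have "\<sigma> \<circ> \<rho> permutes S \<union> R"
      using x by (intro permutes_compose) (auto elim: permutes_subset)
    moreover have "(\<sigma> \<circ> \<rho>) ` S = S"
      using out'[OF x(3)] permutes_image[OF x(2)] by (simp add: image_comp[symmetric])
    ultimately show "(case x of (\<sigma>, \<rho>) \<Rightarrow> \<sigma> \<circ> \<rho>) \<in> ?B" using x by simp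
    have "restrict_id (\<sigma> \<circ> \<rho>) S = \<sigma>"
      using out'[OF x(3)] permutes_not_in[OF x(2)] by (auto simp: restrict_id_def fun_eq_iff)
    moreover have "restrict_id (\<sigma> \<circ> \<rho>) R = \<rho>"
      using out[OF x(2)] permutes_not_in[OF x(3)] permutes_in_image[OF x(3)]
      by (auto simp: restrict_id_def fun_eq_iff)
    ultimately show "(restrict_id (case x of (\<sigma>, \<rho>) \<Rightarrow> \<sigma> \<circ> \<rho>) S, restrict_id (case x of (\<sigma>, \<rho>) \<Rightarrow> \<sigma> \<circ> \<rho>) R) = x"
      using x by simp
  qed
  also have "\<dots> = det_on S A * det_on R A"
    unfolding det_on_def by (simp add: sum_product sum.cartesian_product)
  finally show ?thesis .
qed

section \<open>Laws of interleaved processes\<close>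

lemma measurable_process:
  assumes "binary_process M X"
  shows "(\<lambda>\<omega> m. X m \<omega>) \<in> M \<rightarrow>\<^sub>M config_space UNIV"
  using assms by (intro measurable_abs_UNIV) (simp add: binary_process_def)

lemma measurable_shift: "(\<lambda>x m. x (m + k)) \<in> config_space UNIV \<rightarrow>\<^sub>M config_space UNIV" for k :: int
  by (intro measurable_abs_UNIV measurable_component_singleton) simp

lemma binary_process_shift: "binary_process M X \<Longrightarrow> binary_process M (\<lambda>m. X (m + k))"
  by (simp add: binary_process_def)

lemma process_law_shift:
  assumes "binary_process M X"
  shows "process_law M (\<lambda>m. X (m + k)) = distr (process_law M X) (config_space UNIV) (\<lambda>x m. x (m + k))"
  unfolding process_law_def
  by (subst distr_distr[OF measurable_shift measurable_process[OF assms]]) (simp add: comp_def)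

lemma prob_process_law:
  assumes X: "binary_process M X" and Q: "Measurable.pred (config_space UNIV) Q"
  shows "\<P>(\<omega> in M. Q (\<lambda>m. X m \<omega>)) = measure (process_law M X) {x. Q x}"
proof -
  have "{x. Q x} \<in> sets (config_space UNIV)"
    using Q by (simp add: pred_def space_PiM)
  then show ?thesis
    unfolding process_law_def
    by (subst measure_distr[OF measurable_process[OF X]]) (auto intro!: arg_cong[where f="measure M"])
qed

lemma prob_eq_of_process_law:
  assumes "binary_process M X" "binary_process N X'" "process_law M X = process_law N X'"
    and "Measurable.pred (config_space UNIV) Q"
  shows "\<P>(\<omega> in M. Q (\<lambda>m. X m \<omega>)) = \<P>(\<omega> in N. Q (\<lambda>m. X' m \<omega>))"
  using assms by (simp add: prob_process_law)

lemma stationary_copy: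
  assumes "stationary M Y" "binary_process M Y'" "process_law M Y' = process_law M Y"
  shows "stationary M Y'"
  unfolding stationary_def
proof (intro conjI allI assms(2))
  fix k
  have "process_law M (\<lambda>m. Y' (m + k)) = process_law M (\<lambda>m. Y (m + k))"
    using assms process_law_shift[of M Y k] process_law_shift[of M Y' k] by (simp add: stationary_def)
  then show "process_law M (\<lambda>m. Y' (m + k)) = process_law M Y'"
    using assms by (simp add: stationary_def)
qed

lemma (in prob_space) independent_processesD:
  assumes "independent_processes M U V"
    and Q: "Measurable.pred (config_space UNIV) Q" and R: "Measurable.pred (config_space UNIV) R"
  shows "\<P>(\<omega> in M. Q (\<lambda>m. U m \<omega>) \<and> R (\<lambda>m. V m \<omega>)) =
    \<P>(\<omega> in M. Q (\<lambda>m. U m \<omega>)) * \<P>(\<omega> in M. R (\<lambda>m. V m \<omega>))"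
proof -
  have "{x. Q x} \<in> sets (config_space UNIV)" "{x. R x} \<in> sets (config_space UNIV)"
    using Q R by (simp_all add: pred_def space_PiM)
  from indep_varD[OF assms(1)[unfolded independent_processes_def] this]
  show ?thesis by (simp add: vimage_def Int_def conj_ac)
qed

lemma (in prob_space) independent_processes_shift:
  assumes "independent_processes M U V"
  shows "independent_processes M (\<lambda>m. U (m + k)) (\<lambda>m. V (m + l))"
  using indep_var_compose[OF assms[unfolded independent_processes_def] measurable_shift[of k] measurable_shift[of l]]
  by (simp add: independent_processes_def comp_def)

lemma (in prob_space) independent_processes_sym:
  assumes "independent_processes M U V"
  shows "independent_processes M V U"
proof -
  have "indep_set B A" if "indep_set A B" for A B
    using that unfolding indep_sets2_eq by (metis Int_commute mult.commute)
  then show ?thesis using assms unfolding independent_processes_def indep_var_eq by blast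
qed

definition interleave :: "(int \<Rightarrow> 'c) \<Rightarrow> (int \<Rightarrow> 'c) \<Rightarrow> int \<Rightarrow> 'c" where
  "interleave u v m = (if even m then u (m div 2) else v (m div 2))"

lemma interleave_simps [simp]:
  "interleave u v (2 * m) = u m" "interleave u v (2 * m + 1) = v m"
  by (simp_all add: interleave_def)

lemma binary_process_interleave:
  "binary_process M U \<Longrightarrow> binary_process M V \<Longrightarrow> binary_process M (interleave U V)"
  by (simp add: binary_process_def interleave_def)

lemma (in prob_space) process_law_interleave:
  assumes "independent_processes M U V"
  shows "process_law M (interleave U V) =
    distr (process_law M U \<Otimes>\<^sub>M process_law M V) (config_space UNIV) (\<lambda>(x, y). interleave x y)"
proof -
  let ?C = "config_space UNIV" and ?UV = "\<lambda>\<omega>. ((\<lambda>m. U m \<omega>), (\<lambda>m. V m \<omega>))"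
  have ind: "(\<lambda>\<omega> m. U m \<omega>) \<in> M \<rightarrow>\<^sub>M ?C" "(\<lambda>\<omega> m. V m \<omega>) \<in> M \<rightarrow>\<^sub>M ?C"
      "process_law M U \<Otimes>\<^sub>M process_law M V = distr M (?C \<Otimes>\<^sub>M ?C) ?UV"
    using assms unfolding independent_processes_def indep_var_distribution_eq process_law_def by auto
  have meas: "(\<lambda>(x, y). interleave x y) \<in> ?C \<Otimes>\<^sub>M ?C \<rightarrow>\<^sub>M ?C"
    unfolding split_def
  proof (rule measurable_abs_UNIV)
    fix m :: int
    have "(\<lambda>x. x (m div 2)) \<in> ?C \<rightarrow>\<^sub>M count_space UNIV"
      by (intro measurable_component_singleton) simp
    then show "(\<lambda>p. interleave (fst p) (snd p) m) \<in> ?C \<Otimes>\<^sub>M ?C \<rightarrow>\<^sub>M count_space UNIV"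
      by (cases "even m") (simp_all add: interleave_def measurable_compose[OF measurable_fst]
          measurable_compose[OF measurable_snd])
  qed
  have "distr (process_law M U \<Otimes>\<^sub>M process_law M V) ?C (\<lambda>(x, y). interleave x y) =
      distr M ?C ((\<lambda>(x, y). interleave x y) \<circ> ?UV)"
    unfolding ind(3) by (rule distr_distr[OF meas measurable_Pair[OF ind(1,2)]])
  also have "(\<lambda>(x, y). interleave x y) \<circ> ?UV = (\<lambda>\<omega> m. interleave U V m \<omega>)"
    by (auto simp: fun_eq_iff interleave_def)
  finally show ?thesis by (simp add: process_law_def)
qed

text \<open>A shift by an odd number exchanges the two processes, up to shifts of each. This is where
  both must have the same law.\<close>
lemma (in prob_space) stationary_interleave:
  assumes Y: "stationary M Y" and Y': "binary_process M Y'" "process_law M Y' = process_law M Y"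
    and ind: "independent_processes M Y Y'"
  shows "stationary M (interleave Y Y')"
  unfolding stationary_def
proof (intro conjI allI)
  show "binary_process M (interleave Y Y')"
    using Y Y' by (simp add: binary_process_interleave stationary_def)
  fix k
  have law: "process_law M (\<lambda>m. Y (m + l)) = process_law M Y" "process_law M (\<lambda>m. Y' (m + l)) = process_law M Y" for l
    using Y stationary_copy[OF Y Y'] Y' by (simp_all add: stationary_def)
  show "process_law M (\<lambda>m. interleave Y Y' (m + k)) = process_law M (interleave Y Y')"
  proof (cases "even k")
    case True
    then obtain l where k: "k = 2 * l" by (elim evenE)
    have eq: "(\<lambda>m. interleave Y Y' (m + k)) = interleave (\<lambda>m. Y (m + l)) (\<lambda>m. Y' (m + l))"
      by (auto simp: fun_eq_iff interleave_def k add.commute)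
    show ?thesis
      unfolding eq process_law_interleave[OF ind] process_law_interleave[OF independent_processes_shift[OF ind]]
      by (simp add: law Y')
  next
    case False
    then obtain l where k: "k = 2 * l + 1" by (elim oddE)
    have "interleave Y Y' (m + k) = interleave (\<lambda>m. Y' (m + l)) (\<lambda>m. Y (m + (l + 1))) m" for m
    proof (cases "even m")
      case True
      then obtain j where "m = 2 * j" by (elim evenE)
      then have "m + k = 2 * (j + l) + 1" "m = 2 * j" by (simp_all add: k)
      then show ?thesis by (simp only: interleave_simps)
    next
      case False
      then obtain j where "m = 2 * j + 1" by (elim oddE)
      then have "m + k = 2 * (j + (l + 1))" "m = 2 * j + 1" by (simp_all add: k)
      then show ?thesis by (simp only: interleave_simps)
    qed
    then have eq: "(\<lambda>m. interleave Y Y' (m + k)) = interleave (\<lambda>m. Y' (m + l)) (\<lambda>m. Y (m + (l + 1)))"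
      by (rule ext)
    show ?thesis
      unfolding eq process_law_interleave[OF ind]
        process_law_interleave[OF independent_processes_shift[OF independent_processes_sym[OF ind]]]
      by (simp add: law Y')
  qed
qed

lemma stationary_prob:
  assumes "stationary M Y"
  shows "\<P>(\<omega> in M. Y m \<omega>) = \<P>(\<omega> in M. Y 0 \<omega>)"
proof -
  have bin: "binary_process M Y" using assms by (simp add: stationary_def)
  have "Measurable.pred (config_space UNIV) (\<lambda>x. x (0::int))"
    by (rule measurable_component_singleton) simp
  from prob_eq_of_process_law[OF binary_process_shift[OF bin, of m] bin _ this] show ?thesis
    using assms by (simp add: stationary_def)
qed

section \<open>Determinantal interleavings\<close>

lemma (in prob_space) determinantal_interleave:
  assumes Y: "determinantal M Y" and Y': "binary_process M Y'" "process_law M Y' = process_law M Y"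
    and ind: "independent_processes M Y Y'"
  shows "determinantal M (interleave Y Y')"
proof -
  from Y obtain A :: "int \<Rightarrow> int \<Rightarrow> complex" where bin: "binary_process M Y"
    and herm: "\<And>i j. A j i = cnj (A i j)"
    and A: "\<And>S. finite S \<Longrightarrow> complex_of_real \<P>(\<omega> in M. \<forall>s\<in>S. Y s \<omega>) = det_on S A"
    unfolding determinantal_def by blast
  define K where "K i j = (if even i = even j then A (i div 2) (j div 2) else 0)" for i j
  have "complex_of_real \<P>(\<omega> in M. \<forall>s\<in>S. interleave Y Y' s \<omega>) = det_on S K" if S: "finite S" for S
  proof -
    let ?e = "\<lambda>m::int. 2 * m" and ?o = "\<lambda>m::int. 2 * m + 1"
    define P where "P = ?e -` S"
    define Q where "Q = ?o -` S"
    have fin: "finite P" "finite Q"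
      unfolding P_def Q_def using S by (auto intro!: finite_vimageI injI)
    have split: "S = ?e ` P \<union> ?o ` Q"
    proof (rule set_eqI)
      fix s show "s \<in> S \<longleftrightarrow> s \<in> ?e ` P \<union> ?o ` Q"
        by (cases "even s") (auto simp: P_def Q_def elim!: evenE oddE)
    qed
    have pred: "Measurable.pred (config_space UNIV) (\<lambda>x. \<forall>s\<in>R. x s)" if "finite R" for R :: "int set"
      using that by (intro pred_intros_finite measurable_component_singleton) auto
    have "(\<forall>s\<in>S. interleave Y Y' s \<omega>) \<longleftrightarrow> (\<forall>s\<in>P. Y s \<omega>) \<and> (\<forall>s\<in>Q. Y' s \<omega>)" for \<omega>
      unfolding split by (simp add: ball_Un)
    then have "\<P>(\<omega> in M. \<forall>s\<in>S. interleave Y Y' s \<omega>) =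
        \<P>(\<omega> in M. \<forall>s\<in>P. Y s \<omega>) * \<P>(\<omega> in M. \<forall>s\<in>Q. Y' s \<omega>)"
      using independent_processesD[OF ind pred[OF fin(1)] pred[OF fin(2)]] by simp
    also have "\<P>(\<omega> in M. \<forall>s\<in>Q. Y' s \<omega>) = \<P>(\<omega> in M. \<forall>s\<in>Q. Y s \<omega>)"
      using prob_eq_of_process_law[OF Y'(1) bin Y'(2) pred[OF fin(2)]] by simp
    finally have "complex_of_real \<P>(\<omega> in M. \<forall>s\<in>S. interleave Y Y' s \<omega>) = det_on P A * det_on Q A"
      using A[OF fin(1)] A[OF fin(2)] by simp
    also have "det_on P A = det_on (?e ` P) K"
      using fin(1) by (subst det_on_reindex) (auto simp: inj_on_def K_def)
    also have "det_on Q A = det_on (?o ` Q) K"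
      using fin(2) by (subst det_on_reindex) (auto simp: inj_on_def K_def)
    also have "det_on (?e ` P) K * det_on (?o ` Q) K = det_on S K"
      unfolding split using fin by (intro det_on_block[symmetric]) (auto simp: K_def, presburger)
    finally show ?thesis .
  qed
  moreover have "K j i = cnj (K i j)" for i j
    using herm[of "i div 2" "j div 2"] by (auto simp: K_def)
  ultimately show ?thesis
    using binary_process_interleave[OF bin Y'(1)] unfolding determinantal_def by blast
qed

section \<open>Regeneration of interleaved renewal processes\<close>

text \<open>Clearing the denominators gives a form of the renewal property that is also valid for
  conditions of probability zero, and that depends on the law of \<open>Y\<close> only.\<close>
lemma (in prob_space) renewal_factorization:
  assumes Y: "renewal M Y" and B: "B \<in> sets (config_space {..-1})" and C: "C \<in> sets (config_space {1..})"
  shows "\<P>(\<omega> in M. Y 0 \<omega> \<and> (\<lambda>m\<in>{..-1}. Y m \<omega>) \<in> B \<and> (\<lambda>m\<in>{1..}. Y m \<omega>) \<in> C) * \<P>(\<omega> in M. Y 0 \<omega>) =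
    \<P>(\<omega> in M. Y 0 \<omega> \<and> (\<lambda>m\<in>{..-1}. Y m \<omega>) \<in> B) * \<P>(\<omega> in M. Y 0 \<omega> \<and> (\<lambda>m\<in>{1..}. Y m \<omega>) \<in> C)"
proof -
  have bin: "binary_process M Y"
    using Y by (simp add: renewal_def regenerative_def stationary_def)
  then have [measurable]: "Measurable.pred M (Y m)" for m by (simp add: binary_process_def)
  have [measurable]: "(\<lambda>\<omega>. \<lambda>m\<in>I. Y m \<omega>) \<in> M \<rightarrow>\<^sub>M config_space I" for I
    by (rule measurable_restrict) simp
  note [measurable] = B C
  let ?B = "\<lambda>\<omega>. (\<lambda>m\<in>{..-1}. Y m \<omega>) \<in> B" and ?C = "\<lambda>\<omega>. (\<lambda>m\<in>{1..}. Y m \<omega>) \<in> C"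
  have le: "\<P>(\<omega> in M. Y 0 \<omega> \<and> ?B \<omega> \<and> ?C \<omega>) \<le> \<P>(\<omega> in M. Y 0 \<omega> \<and> ?B \<omega>)"
    by (rule finite_measure_mono) auto
  have le': "\<P>(\<omega> in M. Y 0 \<omega> \<and> ?B \<omega>) \<le> \<P>(\<omega> in M. Y 0 \<omega>)"
    by (rule finite_measure_mono) auto
  show ?thesis
  proof (cases "\<P>(\<omega> in M. Y 0 \<omega> \<and> ?B \<omega>) = 0")
    case True
    then show ?thesis using le by (simp add: measure_le_0_iff)
  next
    case False
    then have pos: "0 < \<P>(\<omega> in M. Y 0 \<omega> \<and> ?B \<omega>)" by (simp add: zero_less_measure_iff)
    have "\<P>(\<omega> in M. ?C \<omega> \<bar> ?B \<omega> \<and> Y 0 \<omega>) = \<P>(\<omega> in M. ?C \<omega> \<bar> Y 0 \<omega>)"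
      using Y B C pos unfolding renewal_def regenerative_def by (simp add: conj_commute)
    then show ?thesis
      using pos le' unfolding cond_prob_def by (simp add: conj_ac field_simps)
  qed
qed

text \<open>An intersection-stable generator of the events that depend on \<open>U\<close> and \<open>V\<close> within \<open>I\<close>.\<close>
definition block_events :: "'a measure \<Rightarrow> (int \<Rightarrow> 'a \<Rightarrow> bool) \<Rightarrow> (int \<Rightarrow> 'a \<Rightarrow> bool) \<Rightarrow> int set \<Rightarrow> 'a set set" where
  "block_events M U V I =
     {{\<omega> \<in> space M. (\<lambda>m\<in>I. U m \<omega>) \<in> B \<and> (\<lambda>m\<in>I. V m \<omega>) \<in> B'} | B B'.
        B \<in> sets (config_space I) \<and> B' \<in> sets (config_space I)}"

lemma Int_stable_block_events: "Int_stable (block_events M U V I)"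
proof (rule Int_stableI)
  fix a b assume "a \<in> block_events M U V I" "b \<in> block_events M U V I"
  then obtain A A' B B' where ab: "A \<in> sets (config_space I)" "A' \<in> sets (config_space I)"
      "B \<in> sets (config_space I)" "B' \<in> sets (config_space I)"
      "a = {\<omega> \<in> space M. (\<lambda>m\<in>I. U m \<omega>) \<in> A \<and> (\<lambda>m\<in>I. V m \<omega>) \<in> A'}"
      "b = {\<omega> \<in> space M. (\<lambda>m\<in>I. U m \<omega>) \<in> B \<and> (\<lambda>m\<in>I. V m \<omega>) \<in> B'}"
    unfolding block_events_def by blast
  then have "a \<inter> b = {\<omega> \<in> space M. (\<lambda>m\<in>I. U m \<omega>) \<in> A \<inter> B \<and> (\<lambda>m\<in>I. V m \<omega>) \<in> A' \<inter> B'}"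
    by auto
  moreover have "A \<inter> B \<in> sets (config_space I)" "A' \<inter> B' \<in> sets (config_space I)"
    using ab by auto
  ultimately show "a \<inter> b \<in> block_events M U V I" unfolding block_events_def by blast
qed

lemma block_events_generate:
  assumes J: "\<And>j. j \<in> J \<Longrightarrow> \<exists>k\<in>I. W j = U k \<or> W j = V k"
    and B: "B \<in> sets (config_space J)"
  shows "{\<omega> \<in> space M. (\<lambda>m\<in>J. W m \<omega>) \<in> B} \<in> sigma_sets (space M) (block_events M U V I)"
proof -
  have sub: "block_events M U V I \<subseteq> Pow (space M)" by (auto simp: block_events_def)
  let ?S = "sigma (space M) (block_events M U V I)"
  have "(\<lambda>\<omega>. \<lambda>m\<in>J. W m \<omega>) \<in> ?S \<rightarrow>\<^sub>M config_space J"
  proof (rule measurable_restrict)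
    fix j assume "j \<in> J"
    then obtain k where k: "k \<in> I" "W j = U k \<or> W j = V k" using J by blast
    let ?K = "{x \<in> space (config_space I). x k}"
    have "Measurable.pred (config_space I) (\<lambda>x. x k)"
      by (rule measurable_component_singleton) (rule k(1))
    then have K: "?K \<in> sets (config_space I)" by (simp add: pred_def)
    have "{\<omega> \<in> space M. U k \<omega>} = {\<omega> \<in> space M. (\<lambda>m\<in>I. U m \<omega>) \<in> ?K \<and> (\<lambda>m\<in>I. V m \<omega>) \<in> space (config_space I)}"
      "{\<omega> \<in> space M. V k \<omega>} = {\<omega> \<in> space M. (\<lambda>m\<in>I. U m \<omega>) \<in> space (config_space I) \<and> (\<lambda>m\<in>I. V m \<omega>) \<in> ?K}"
      using k(1) by (auto simp: space_PiM)
    then have "{\<omega> \<in> space M. U k \<omega>} \<in> block_events M U V I" "{\<omega> \<in> space M. V k \<omega>} \<in> block_events M U V I"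
      using K sets.top unfolding block_events_def by blast+
    then have "{\<omega> \<in> space M. W j \<omega>} \<in> block_events M U V I" using k(2) by auto
    then show "W j \<in> ?S \<rightarrow>\<^sub>M count_space UNIV"
      unfolding pred_def using sub by (simp add: space_measure_of sets_measure_of sigma_sets.Basic)
  qed
  from measurable_sets[OF this B] show ?thesis
    using sub by (simp add: space_measure_of sets_measure_of vimage_def Int_def conj_commute)
qed

lemma pred_restrict_in:
  assumes "B \<in> sets (config_space I)"
  shows "Measurable.pred (config_space UNIV) (\<lambda>x. restrict x I \<in> B)"
  using measurable_restrict_subset[of I UNIV "\<lambda>_. count_space UNIV"] assms by measurable

text \<open>Given \<open>E\<close>, the events of \<open>(U, V)\<close> within \<open>I\<close> are independent of those within \<open>J\<close>. For
  the generators, all probabilities split into a factor for \<open>U\<close> and a factor for \<open>V\<close>, and \<open>factor\<close>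
  applies to each; independence extends to the generated algebras under the conditional measure.\<close>
lemma (in prob_space) cond_indep_blocks:
  fixes U V :: "int \<Rightarrow> 'a \<Rightarrow> bool" and I J :: "int set"
  assumes bin: "binary_process M U" "binary_process M V" and ind: "independent_processes M U V"
    and factor: "\<And>X B C. X \<in> {U, V} \<Longrightarrow> B \<in> sets (config_space I) \<Longrightarrow> C \<in> sets (config_space J) \<Longrightarrow>
      \<P>(\<omega> in M. X 0 \<omega> \<and> (\<lambda>m\<in>I. X m \<omega>) \<in> B \<and> (\<lambda>m\<in>J. X m \<omega>) \<in> C) * \<P>(\<omega> in M. X 0 \<omega>) =
      \<P>(\<omega> in M. X 0 \<omega> \<and> (\<lambda>m\<in>I. X m \<omega>) \<in> B) * \<P>(\<omega> in M. X 0 \<omega> \<and> (\<lambda>m\<in>J. X m \<omega>) \<in> C)"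
    and a: "a \<in> sigma_sets (space M) (block_events M U V I)"
    and b: "b \<in> sigma_sets (space M) (block_events M U V J)"
  defines "E \<equiv> {\<omega> \<in> space M. U 0 \<omega> \<and> V 0 \<omega>}"
  shows "prob (E \<inter> (a \<inter> b)) * prob E = prob (E \<inter> a) * prob (E \<inter> b)"
proof (cases "prob E = 0")
  have [measurable]: "Measurable.pred M (U m)" "Measurable.pred M (V m)" for m
    using bin by (simp_all add: binary_process_def)
  have E [measurable]: "E \<in> events" unfolding E_def by measurable
  {
    case True
    have "prob (E \<inter> a) \<le> prob E" by (rule finite_measure_mono) (auto intro: E)
    then show ?thesis using True by (simp add: measure_le_0_iff)
  next
    case False
    then have E0: "emeasure M E \<noteq> 0" "emeasure M E \<noteq> \<infinity>" by (auto simp: emeasure_eq_measure)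
    define N where "N = uniform_measure M E"
    interpret N: prob_space N unfolding N_def by (rule prob_space_uniform_measure[OF E0])
    have N: "space N = space M" "sets N = sets M" by (simp_all add: N_def)
    have prob_N: "N.prob A = prob (E \<inter> A) / prob E" if "A \<in> events" for A
      unfolding N_def using E0 that by simp
    have restr [measurable]: "(\<lambda>\<omega>. \<lambda>m\<in>K. U m \<omega>) \<in> M \<rightarrow>\<^sub>M config_space K"
      "(\<lambda>\<omega>. \<lambda>m\<in>K. V m \<omega>) \<in> M \<rightarrow>\<^sub>M config_space K" for K
      by (rule measurable_restrict, simp)+
    have ev: "block_events M U V K \<subseteq> events" for K
    proof
      fix x assume "x \<in> block_events M U V K"
      then obtain B B' where [measurable]: "B \<in> sets (config_space K)" "B' \<in> sets (config_space K)"
        and x: "x = {\<omega> \<in> space M. (\<lambda>m\<in>K. U m \<omega>) \<in> B \<and> (\<lambda>m\<in>K. V m \<omega>) \<in> B'}"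
        unfolding block_events_def by blast
      show "x \<in> events" unfolding x by measurable
    qed
    have alg: "(r * s) * (p * q) = (r1 * s1) * (r2 * s2)"
      if "r * p = r1 * r2" "s * q = s1 * s2" for p q r s r1 s1 r2 s2 :: real
    proof -
      have "(r * s) * (p * q) = (r * p) * (s * q)" by simp
      also have "\<dots> = (r1 * s1) * (r2 * s2)" unfolding that by simp
      finally show ?thesis .
    qed
    have "N.indep_set (block_events M U V I) (block_events M U V J)"
    proof (rule N.indep_setI)
      show "block_events M U V I \<subseteq> N.events" "block_events M U V J \<subseteq> N.events"
        using ev N by auto
      fix x y assume xy: "x \<in> block_events M U V I" "y \<in> block_events M U V J"
      then have xy_ev: "x \<in> events" "y \<in> events" using ev by auto
      from xy obtain B B' C C' where B: "B \<in> sets (config_space I)" "B' \<in> sets (config_space I)"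
        and C: "C \<in> sets (config_space J)" "C' \<in> sets (config_space J)"
        and x: "x = {\<omega> \<in> space M. (\<lambda>m\<in>I. U m \<omega>) \<in> B \<and> (\<lambda>m\<in>I. V m \<omega>) \<in> B'}"
        and y: "y = {\<omega> \<in> space M. (\<lambda>m\<in>J. U m \<omega>) \<in> C \<and> (\<lambda>m\<in>J. V m \<omega>) \<in> C'}"
        unfolding block_events_def by blast
      note [measurable] = pred_restrict_in[OF B(1)] pred_restrict_in[OF B(2)]
        pred_restrict_in[OF C(1)] pred_restrict_in[OF C(2)]
      have [measurable]: "Measurable.pred (config_space UNIV) (\<lambda>x. x (0::int))"
        by (rule measurable_component_singleton) simp
      have "prob E = \<P>(\<omega> in M. U 0 \<omega>) * \<P>(\<omega> in M. V 0 \<omega>)"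
        unfolding E_def
        by (rule independent_processesD[OF ind, of "\<lambda>x. x 0" "\<lambda>x. x 0"]) measurable
      moreover have "prob (E \<inter> x) = \<P>(\<omega> in M. U 0 \<omega> \<and> (\<lambda>m\<in>I. U m \<omega>) \<in> B) * \<P>(\<omega> in M. V 0 \<omega> \<and> (\<lambda>m\<in>I. V m \<omega>) \<in> B')"
        unfolding E_def x
        by (subst independent_processesD[OF ind, of "\<lambda>x. x 0 \<and> restrict x I \<in> B" "\<lambda>x. x 0 \<and> restrict x I \<in> B'", symmetric])
          (measurable, auto intro!: arg_cong[where f=prob])
      moreover have "prob (E \<inter> y) = \<P>(\<omega> in M. U 0 \<omega> \<and> (\<lambda>m\<in>J. U m \<omega>) \<in> C) * \<P>(\<omega> in M. V 0 \<omega> \<and> (\<lambda>m\<in>J. V m \<omega>) \<in> C')"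
        unfolding E_def y
        by (subst independent_processesD[OF ind, of "\<lambda>x. x 0 \<and> restrict x J \<in> C" "\<lambda>x. x 0 \<and> restrict x J \<in> C'", symmetric])
          (measurable, auto intro!: arg_cong[where f=prob])
      moreover have "prob (E \<inter> (x \<inter> y)) =
          \<P>(\<omega> in M. U 0 \<omega> \<and> (\<lambda>m\<in>I. U m \<omega>) \<in> B \<and> (\<lambda>m\<in>J. U m \<omega>) \<in> C) *
          \<P>(\<omega> in M. V 0 \<omega> \<and> (\<lambda>m\<in>I. V m \<omega>) \<in> B' \<and> (\<lambda>m\<in>J. V m \<omega>) \<in> C')"
        unfolding E_def x y
        by (subst independent_processesD[OF ind, of "\<lambda>x. x 0 \<and> restrict x I \<in> B \<and> restrict x J \<in> C"
              "\<lambda>x. x 0 \<and> restrict x I \<in> B' \<and> restrict x J \<in> C'", symmetric])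
          (measurable, auto intro!: arg_cong[where f=prob])
      ultimately have "prob (E \<inter> (x \<inter> y)) * prob E = prob (E \<inter> x) * prob (E \<inter> y)"
        using alg[OF factor[of U B C] factor[of V B' C']] B C by simp
      then show "N.prob (x \<inter> y) = N.prob x * N.prob y"
        using False xy_ev by (simp add: prob_N field_simps)
    qed
    from N.indep_set_sigma_sets[OF this Int_stable_block_events Int_stable_block_events]
    have "N.prob (a \<inter> b) = N.prob a * N.prob b"
      using a b by (intro N.indep_setD) (simp_all add: N)
    moreover have "a \<in> events" "b \<in> events"
      using a b sets.sigma_sets_subset[OF ev] by auto
    ultimately show ?thesis using False by (simp add: prob_N field_simps)
  }
qed

text \<open>Shifting \<open>Y'\<close> by one step moves the two ones of the interleaving, at \<open>-1\<close> and \<open>0\<close>, to time \<open>0\<close>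
  of both processes. The coordinates up to \<open>-2\<close> of the interleaving are then read off from the negative
  times of both, and those from \<open>1\<close> on from their positive times.\<close>
lemma (in prob_space) regenerative_interleave:
  assumes Y: "renewal M Y" and Y': "binary_process M Y'" "process_law M Y' = process_law M Y"
    and ind: "independent_processes M Y Y'"
  shows "regenerative 2 M (interleave Y Y')"
proof -
  have stat: "stationary M Y" using Y by (simp add: renewal_def regenerative_def)
  then have binY: "binary_process M Y" by (simp add: stationary_def)
  define V where "V = (\<lambda>m. Y' (m + (-1)))"
  define Z where "Z = interleave Y Y'"
  have binV: "binary_process M V" unfolding V_def by (rule binary_process_shift[OF Y'(1)])
  have lawV: "process_law M V = process_law M Y"
    using stationary_copy[OF stat Y'] Y'(2) unfolding V_def stationary_def by metis
  have indV: "independent_processes M Y V"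
    using independent_processes_shift[OF ind, of 0 "-1"] by (simp add: V_def)
  have even: "Z (2 * m) = Y m" for m by (simp add: Z_def)
  have odd: "Z (2 * m - 1) = V m" for m
    using interleave_simps(2)[of Y Y' "m - 1"] by (simp add: Z_def V_def algebra_simps)
  have Z0: "Z 0 = Y 0" "Z (-1) = V 0" using even[of 0] odd[of 0] by simp_all
  have cover: "\<exists>k. (j = 2 * k \<or> j = 2 * k - 1) \<and> (Z j = Y k \<or> Z j = V k)" for j
  proof (cases "even j")
    case True
    then show ?thesis using even by (metis evenE)
  next
    case False
    then obtain k where "j = 2 * (k + 1) - 1" by (elim oddE) simp
    then show ?thesis using odd by metis
  qed
  have past: "\<exists>k\<in>{..-1}. Z j = Y k \<or> Z j = V k" if "j \<in> {..-2}" for j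
    using cover[of j] that by force
  have future: "\<exists>k\<in>{1..}. Z j = Y k \<or> Z j = V k" if "j \<in> {1..}" for j
    using cover[of j] that by force
  have factor: "\<P>(\<omega> in M. X 0 \<omega> \<and> (\<lambda>m\<in>{..-1}. X m \<omega>) \<in> B \<and> (\<lambda>m\<in>{1..}. X m \<omega>) \<in> C) * \<P>(\<omega> in M. X 0 \<omega>) =
      \<P>(\<omega> in M. X 0 \<omega> \<and> (\<lambda>m\<in>{..-1}. X m \<omega>) \<in> B) * \<P>(\<omega> in M. X 0 \<omega> \<and> (\<lambda>m\<in>{1..}. X m \<omega>) \<in> C)"
    if X: "X \<in> {Y, V}" and B: "B \<in> sets (config_space {..-1})" and C: "C \<in> sets (config_space {1..})" for X B C
  proof -
    have bin: "binary_process M X" and law: "process_law M X = process_law M Y"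
      using X binY binV lawV by auto
    note [measurable] = pred_restrict_in[OF B] pred_restrict_in[OF C]
    have [measurable]: "Measurable.pred (config_space UNIV) (\<lambda>x. x (0::int))"
      by (rule measurable_component_singleton) simp
    note eq = prob_eq_of_process_law[OF bin binY law]
    show ?thesis
      using renewal_factorization[OF Y B C]
        eq[of "\<lambda>x. x 0"] eq[of "\<lambda>x. x 0 \<and> restrict x {..-1} \<in> B"] eq[of "\<lambda>x. x 0 \<and> restrict x {1..} \<in> C"]
        eq[of "\<lambda>x. x 0 \<and> restrict x {..-1} \<in> B \<and> restrict x {1..} \<in> C"]
      by simp
  qed
  show ?thesis
    unfolding regenerative_def Z_def[symmetric]
  proof (intro conjI ballI impI)
    show "stationary M Z" unfolding Z_def by (rule stationary_interleave[OF stat Y' ind])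
    fix B C assume B: "B \<in> sets (config_space {..- int 2})" and C: "C \<in> sets (config_space {1..})"
    have B': "B \<in> sets (config_space {..-2})" using B by simp
    have J: "{- int 2 + 1..0} = {-1, 0}" by auto
    define E where "E = {\<omega> \<in> space M. Y 0 \<omega> \<and> V 0 \<omega>}"
    define a where "a = {\<omega> \<in> space M. (\<lambda>m\<in>{..-2}. Z m \<omega>) \<in> B}"
    define b where "b = {\<omega> \<in> space M. (\<lambda>m\<in>{1..}. Z m \<omega>) \<in> C}"
    assume "0 < \<P>(\<omega> in M. (\<lambda>m\<in>{..- int 2}. Z m \<omega>) \<in> B \<and> (\<forall>j\<in>{- int 2 + 1..0}. Z j \<omega>))"
    also have "{\<omega> \<in> space M. (\<lambda>m\<in>{..- int 2}. Z m \<omega>) \<in> B \<and> (\<forall>j\<in>{- int 2 + 1..0}. Z j \<omega>)} = E \<inter> a"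
      unfolding J by (auto simp: E_def a_def Z0)
    finally have pos: "0 < prob (E \<inter> a)" .
    have "prob (E \<inter> (a \<inter> b)) * prob E = prob (E \<inter> a) * prob (E \<inter> b)"
      unfolding E_def
    proof (rule cond_indep_blocks[OF binY binV indV factor])
      show "a \<in> sigma_sets (space M) (block_events M Y V {..-1})"
        unfolding a_def using past B' by (rule block_events_generate)
      show "b \<in> sigma_sets (space M) (block_events M Y V {1..})"
        unfolding b_def using future C by (rule block_events_generate)
    qed
    moreover have "prob E \<noteq> 0"
    proof -
      have "Measurable.pred M (Y 0)" "Measurable.pred M (V 0)"
        using binY binV by (simp_all add: binary_process_def)
      then have "E \<in> events" unfolding E_def by measurable
      then have "prob (E \<inter> a) \<le> prob E" by (intro finite_measure_mono) auto
      then show ?thesis using pos by simp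
    qed
    ultimately have "prob (E \<inter> (a \<inter> b)) / prob (E \<inter> a) = prob (E \<inter> b) / prob E"
      using pos by (simp add: field_simps)
    moreover have "{\<omega> \<in> space M. (\<lambda>m\<in>{1..}. Z m \<omega>) \<in> C \<and> (\<lambda>m\<in>{..- int 2}. Z m \<omega>) \<in> B \<and> (\<forall>j\<in>{- int 2 + 1..0}. Z j \<omega>)}
        = E \<inter> (a \<inter> b)"
      "{\<omega> \<in> space M. (\<lambda>m\<in>{..- int 2}. Z m \<omega>) \<in> B \<and> (\<forall>j\<in>{- int 2 + 1..0}. Z j \<omega>)} = E \<inter> a"
      "{\<omega> \<in> space M. (\<lambda>m\<in>{1..}. Z m \<omega>) \<in> C \<and> (\<forall>j\<in>{- int 2 + 1..0}. Z j \<omega>)} = E \<inter> b"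
      "{\<omega> \<in> space M. \<forall>j\<in>{- int 2 + 1..0}. Z j \<omega>} = E"
      unfolding J by (auto simp: E_def a_def b_def Z0)
    ultimately show "\<P>(\<omega> in M. (\<lambda>m\<in>{1..}. Z m \<omega>) \<in> C \<bar>
          (\<lambda>m\<in>{..- int 2}. Z m \<omega>) \<in> B \<and> (\<forall>j\<in>{- int 2 + 1..0}. Z j \<omega>)) =
        \<P>(\<omega> in M. (\<lambda>m\<in>{1..}. Z m \<omega>) \<in> C \<bar> \<forall>j\<in>{- int 2 + 1..0}. Z j \<omega>)"
      unfolding cond_prob_def by simp
  qed simp
qed

section \<open>Interleavings and thinned spanning trees\<close>

lemma independent_processes_binary:
  assumes "prob_space M" "independent_processes M U V"
  shows "binary_process M U" "binary_process M V"
proof -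
  interpret prob_space M by fact
  have comp: "(\<lambda>x. x m) \<in> config_space UNIV \<rightarrow>\<^sub>M count_space UNIV" for m
    by (rule measurable_component_singleton) simp
  have "(\<lambda>\<omega> m. U m \<omega>) \<in> M \<rightarrow>\<^sub>M config_space UNIV" "(\<lambda>\<omega> m. V m \<omega>) \<in> M \<rightarrow>\<^sub>M config_space UNIV"
    using assms(2) unfolding independent_processes_def indep_var_distribution_eq by auto
  from this[THEN measurable_compose, OF comp] show "binary_process M U" "binary_process M V"
    by (simp_all add: binary_process_def)
qed

lemma (in prob_space) iid_bernoulli_zero:
  assumes bin: "binary_process M Y" and zero: "\<And>m. \<P>(\<omega> in M. Y m \<omega>) = 0"
  shows "iid_bernoulli M 0 Y"
  unfolding iid_bernoulli_def
proof (intro conjI allI)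
  have meas [measurable]: "Y m \<in> M \<rightarrow>\<^sub>M count_space UNIV" for m
    using bin by (simp add: binary_process_def)
  have ae: "AE \<omega> in M. \<not> Y m \<omega>" for m
    using zero[of m] by (subst AE_iff_measurable[OF _ refl]) (auto simp: emeasure_eq_measure)
  show "distr M (count_space UNIV) (Y m) = measure_pmf (bernoulli_pmf 0)" for m
  proof -
    have "distr M (count_space UNIV) (Y m) = distr M (count_space UNIV) (\<lambda>_. False)"
      using ae[of m] by (intro distr_cong_AE) auto
    also have "\<dots> = measure_pmf (return_pmf False)"
      by (simp add: distr_const return_pmf.rep_eq)
    also have "return_pmf False = bernoulli_pmf 0"
      by (rule pmf_eqI) (simp add: pmf_bernoulli_False pmf_bernoulli_True split: split_indicator)
    finally show ?thesis .
  qed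
  have prob_Y: "prob (Y m -` A \<inter> space M) = of_bool (False \<in> A)" for m A
  proof -
    have "prob (Y m -` A \<inter> space M) = prob {\<omega> \<in> space M. False \<in> A}"
      using ae[of m] by (intro finite_measure_eq_AE) (auto elim!: AE_mp)
    then show ?thesis by (simp add: prob_space)
  qed
  show "indep_vars (\<lambda>_. count_space UNIV) Y UNIV"
    unfolding indep_vars_def2
  proof (intro conjI ballI indep_setsI)
    fix A and J :: "int set"
    assume J: "J \<noteq> {}" "finite J" "\<forall>j\<in>J. A j \<in> {Y j -` S \<inter> space M | S. S \<in> sets (count_space UNIV)}"
    then have "\<forall>j\<in>J. \<exists>S. A j = Y j -` S \<inter> space M" by blast
    from bchoice[OF this] obtain S where S: "\<And>j. j \<in> J \<Longrightarrow> A j = Y j -` S j \<inter> space M"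
      by blast
    have "AE \<omega> in M. \<forall>j\<in>J. \<not> Y j \<omega>"
      using ae J(2) by (intro AE_finite_allI)
    then have "AE \<omega> in M. \<omega> \<in> (\<Inter>j\<in>J. A j) \<longleftrightarrow> \<omega> \<in> {\<omega> \<in> space M. \<forall>j\<in>J. False \<in> S j}"
      using AE_space
    proof eventually_elim
      case (elim \<omega>)
      have "\<omega> \<in> A j \<longleftrightarrow> False \<in> S j" if "j \<in> J" for j
        using elim that by (simp add: S)
      then show ?case using elim(2) J(1) by simp
    qed
    moreover have "(\<Inter>j\<in>J. A j) \<in> events"
      using J(1,2) by (intro sets.finite_INT) (simp_all add: S)
    ultimately have "prob (\<Inter>j\<in>J. A j) = prob {\<omega> \<in> space M. \<forall>j\<in>J. False \<in> S j}"
      by (intro finite_measure_eq_AE) auto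
    also have "\<dots> = of_bool (\<forall>j\<in>J. False \<in> S j)"
    proof (cases "\<forall>j\<in>J. False \<in> S j")
      case False
      then show ?thesis by (simp only: False) simp
    qed (simp add: prob_space)
    also have "\<dots> = (\<Prod>j\<in>J. of_bool (False \<in> S j))" using J(2) by (induction J rule: finite_induct) auto
    also have "\<dots> = (\<Prod>j\<in>J. prob (A j))" by (rule prod.cong) (simp_all add: S prob_Y)
    finally show "prob (\<Inter>j\<in>J. A j) = (\<Prod>j\<in>J. prob (A j))" .
  qed auto
qed

lemma (in prob_space)
  assumes "iid_bernoulli M p B" and p: "0 \<le> p" "p \<le> 1"
  shows iid_bernoulli_prob: "\<P>(\<omega> in M. B m \<omega>) = p"
    and iid_bernoulli_prob2: "m \<noteq> l \<Longrightarrow> \<P>(\<omega> in M. B m \<omega> \<and> B l \<omega>) = p\<^sup>2"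
proof -
  have ind: "indep_vars (\<lambda>_. count_space UNIV) B UNIV"
    and law: "distr M (count_space UNIV) (B m) = measure_pmf (bernoulli_pmf p)" for m
    using assms(1) by (auto simp: iid_bernoulli_def)
  have meas: "B m \<in> M \<rightarrow>\<^sub>M count_space UNIV" for m
    using ind by (simp add: indep_vars_def2)
  have one: "prob (B m -` {True} \<inter> space M) = p" for m
  proof -
    have "prob (B m -` {True} \<inter> space M) = measure (distr M (count_space UNIV) (B m)) {True}"
      by (rule measure_distr[OF meas, symmetric]) simp
    then show ?thesis using p unfolding law by (simp add: measure_pmf_single)
  qed
  show "\<P>(\<omega> in M. B m \<omega>) = p"
    using one[of m] by (simp add: vimage_def Int_def conj_commute)
  assume ml: "m \<noteq> l"
  have "prob (\<Inter>i\<in>{m, l}. B i -` {True} \<inter> space M) = (\<Prod>i\<in>{m, l}. prob (B i -` {True} \<inter> space M))"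
    by (rule indep_varsD[OF ind]) auto
  then have "prob (\<Inter>i\<in>{m, l}. B i -` {True} \<inter> space M) = p\<^sup>2"
    using ml by (simp add: one power2_eq_square)
  moreover have "(\<Inter>i\<in>{m, l}. B i -` {True} \<inter> space M) = {\<omega> \<in> space M. B m \<omega> \<and> B l \<omega>}"
    by auto
  ultimately show "\<P>(\<omega> in M. B m \<omega> \<and> B l \<omega>) = p\<^sup>2" by simp
qed

text \<open>The densities and the two-point probabilities of \<open>X\<close> at odd distance are found by dividing
  those of the interleaving by \<open>p\<close> and \<open>p\<^sup>2\<close>.\<close>
lemma not_thinned_helix_process:
  fixes N :: "'b measure" and M :: "'a measure"
  assumes M: "prob_space M" and Y: "stationary M Y" and pos: "\<P>(\<omega> in M. Y 0 \<omega>) \<noteq> 0"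
    and Y': "binary_process M Y'" "process_law M Y' = process_law M Y"
    and ind: "independent_processes M Y Y'"
    and N: "prob_space N" and T: "weighted_random_tree c d N T"
    and cdp: "0 < c" "0 \<le> d" "0 \<le> p" "p \<le> 1"
    and X: "\<And>m \<omega>. X m \<omega> \<longleftrightarrow> z_edge m \<in> T \<omega>"
    and B: "iid_bernoulli N p B" and XB: "independent_processes N X B"
    and law: "process_law N (\<lambda>m \<omega>. X m \<omega> \<and> B m \<omega>) = process_law M (interleave Y Y')"
  shows False
proof -
  interpret M: prob_space M by fact
  interpret N: prob_space N by fact
  define q where "q = \<P>(\<omega> in M. Y 0 \<omega>)"
  define \<alpha> where "\<alpha> = q / p"
  have coord [measurable]: "Measurable.pred (config_space UNIV) (\<lambda>x. x m)" for m :: int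
    by (rule measurable_component_singleton) simp
  have bin: "binary_process N X" "binary_process N B"
    using independent_processes_binary[OF N XB] by auto
  have binXB: "binary_process N (\<lambda>m \<omega>. X m \<omega> \<and> B m \<omega>)"
    unfolding binary_process_def
  proof
    fix m
    have [measurable]: "Measurable.pred N (X m)" "Measurable.pred N (B m)"
      using bin by (simp_all add: binary_process_def)
    show "Measurable.pred N (\<lambda>\<omega>. X m \<omega> \<and> B m \<omega>)" by measurable
  qed
  have binZ: "binary_process M (interleave Y Y')"
    using Y Y' by (intro binary_process_interleave) (auto simp: stationary_def)
  have qY: "\<P>(\<omega> in M. Y m \<omega>) = q" "\<P>(\<omega> in M. Y' m \<omega>) = q" for m
  proof -
    show Ym: "\<P>(\<omega> in M. Y m \<omega>) = q" for m
      unfolding q_def by (rule stationary_prob[OF Y])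
    have "binary_process M Y" using Y by (simp add: stationary_def)
    from prob_eq_of_process_law[OF Y'(1) this Y'(2) coord] show "\<P>(\<omega> in M. Y' m \<omega>) = q"
      by (simp add: Ym)
  qed
  have one: "\<P>(\<omega> in N. X m \<omega>) * p = q" for m
  proof -
    have "\<P>(\<omega> in N. X m \<omega>) * p = \<P>(\<omega> in N. X m \<omega> \<and> B m \<omega>)"
      using N.independent_processesD[OF XB coord coord] N.iid_bernoulli_prob[OF B] cdp by simp
    also have "\<dots> = \<P>(\<omega> in M. interleave Y Y' m \<omega>)"
      using prob_eq_of_process_law[OF binXB binZ law coord] .
    also have "\<dots> = q" by (simp add: interleave_def qY)
    finally show ?thesis .
  qed
  have p: "p \<noteq> 0" using one[of 0] pos by (auto simp: q_def)
  have two: "\<P>(\<omega> in N. X m \<omega> \<and> X 0 \<omega>) = \<alpha>\<^sup>2" if m: "odd m" for m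
  proof -
    have "m \<noteq> 0" using m by auto
    have "\<P>(\<omega> in N. X m \<omega> \<and> X 0 \<omega>) * p\<^sup>2 = \<P>(\<omega> in N. (X m \<omega> \<and> X 0 \<omega>) \<and> (B m \<omega> \<and> B 0 \<omega>))"
      using N.independent_processesD[OF XB, of "\<lambda>x. x m \<and> x 0" "\<lambda>x. x m \<and> x 0"]
        N.iid_bernoulli_prob2[OF B _ _ \<open>m \<noteq> 0\<close>] cdp by simp
    also have "\<dots> = \<P>(\<omega> in N. (X m \<omega> \<and> B m \<omega>) \<and> (X 0 \<omega> \<and> B 0 \<omega>))"
      by (simp add: conj_ac)
    also have "\<dots> = \<P>(\<omega> in M. interleave Y Y' m \<omega> \<and> interleave Y Y' 0 \<omega>)"
      using prob_eq_of_process_law[OF binXB binZ law, of "\<lambda>x. x m \<and> x 0"] by simp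
    also have "\<dots> = \<P>(\<omega> in M. Y 0 \<omega> \<and> Y' (m div 2) \<omega>)"
      using m by (simp add: interleave_def conj_commute)
    also have "\<dots> = q * q"
      using M.independent_processesD[OF ind coord coord] by (simp add: qY)
    finally show ?thesis using p by (simp add: \<alpha>_def field_simps power2_eq_square)
  qed
  have "\<alpha> = 0"
  proof (rule helix_odd_lags_uncorrelated[OF N T cdp(1,2)])
    show "\<P>(\<omega> in N. z_edge m \<in> T \<omega>) = \<alpha>" for m
      using one[of m] p by (simp add: X[symmetric] \<alpha>_def field_simps)
    show "\<P>(\<omega> in N. z_edge m \<in> T \<omega> \<and> z_edge 0 \<in> T \<omega>) = \<alpha>\<^sup>2" if "odd m" for m
      using two[OF that] by (simp add: X[symmetric])
  qed
  then show False using pos p by (simp add: \<alpha>_def q_def)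
qed

theorem mainTheorem9:
  fixes M :: "'a measure" and Y Y' Z :: "int \<Rightarrow> 'a \<Rightarrow> bool"
  assumes "prob_space M"
    and "stationary M Y" and "renewal M Y" and "determinantal M Y"
    and nontrivial: "\<not> (\<exists>q\<in>{0..1}. iid_bernoulli M q Y)"
    and copy: "binary_process M Y'" "process_law M Y' = process_law M Y"
      "independent_processes M Y Y'"
    and Z: "\<And>m. Z (2 * m) = Y m" "\<And>m. Z (2 * m + 1) = Y' m"
  shows "determinantal M Z \<and> regenerative 2 M Z \<and>
    \<not> (\<exists>c d p. 0 < c \<and> 0 \<le> d \<and> 0 \<le> p \<and> p \<le> 1 \<and>
        (\<exists>(N :: 'b measure) T X B. prob_space N \<and> weighted_random_tree c d N T \<and>
           (\<forall>m \<omega>. X m \<omega> \<longleftrightarrow> z_edge m \<in> T \<omega>) \<and>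
           iid_bernoulli N p B \<and> independent_processes N X B \<and>
           process_law N (\<lambda>m \<omega>. X m \<omega> \<and> B m \<omega>) = process_law M Z))"
proof -
  interpret prob_space M by fact
  have "Z m = interleave Y Y' m" for m
    using Z(1)[of "m div 2"] Z(2)[of "m div 2"] by (cases "even m") (simp_all add: interleave_def)
  then have ZI: "Z = interleave Y Y'" by (rule ext)
  have pos: "\<P>(\<omega> in M. Y 0 \<omega>) \<noteq> 0"
  proof
    assume "\<P>(\<omega> in M. Y 0 \<omega>) = 0"
    then have "iid_bernoulli M 0 Y"
      using assms(2) stationary_prob[OF assms(2)]
      by (intro iid_bernoulli_zero) (simp_all add: stationary_def)
    then show False using nontrivial by auto
  qed
  show ?thesis
    unfolding ZI
  proof (intro conjI notI)
    show "determinantal M (interleave Y Y')"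
      by (rule determinantal_interleave[OF assms(4) copy])
    show "regenerative 2 M (interleave Y Y')"
      by (rule regenerative_interleave[OF assms(3) copy])
    assume "\<exists>c d p. 0 < c \<and> 0 \<le> d \<and> 0 \<le> p \<and> p \<le> 1 \<and>
        (\<exists>(N :: 'b measure) T X B. prob_space N \<and> weighted_random_tree c d N T \<and>
           (\<forall>m \<omega>. X m \<omega> \<longleftrightarrow> z_edge m \<in> T \<omega>) \<and>
           iid_bernoulli N p B \<and> independent_processes N X B \<and>
           process_law N (\<lambda>m \<omega>. X m \<omega> \<and> B m \<omega>) = process_law M (interleave Y Y'))"
    then obtain c d p and N :: "'b measure" and T X B where
      *: "0 < c" "0 \<le> d" "0 \<le> p" "p \<le> 1" "prob_space N" "weighted_random_tree c d N T"
      "\<And>m \<omega>. X m \<omega> \<longleftrightarrow> z_edge m \<in> T \<omega>" "iid_bernoulli N p B" "independent_processes N X B"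
      "process_law N (\<lambda>m \<omega>. X m \<omega> \<and> B m \<omega>) = process_law M (interleave Y Y')"
      by blast
    show False
      by (rule not_thinned_helix_process[OF assms(1,2) pos copy *(5,6,1-4,7-10)])
  qed
qed

end
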